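(* Let $k$ be a field, let $S=k[x_1,\dots,x_n]$, and let $I\subset S$ be a nonzero proper squarefree monomial ideal. Let $\mathcal{N}(I^\vee)$ be the Stanley–Reisner complex of the Alexander dual of $I$. Then the following statements are equivalent. (1) $\mathrm{pd}_S(I)\le 1$. (2) $\mathcal{N}(I^\vee)$ is a quasi-forest. (3) $S/I$ has a minimal free resolution supported on a tree (in the sense of graph theory).
   Context: Simplicial complexes. A simplicial complex $\Delta$ on a finite set $V$ is a collection of subsets of $V$ (faces) closed under taking subsets; facets are the maximal faces; $\langle F_1,\dots,F_q\rangle$ denotes the complex with facets $F_1,\dots,F_q$. The empty set is counted as a face, and the complex $\{\emptyset\}$ has the single facet $\emptyset$; not every element of $V$ need be a vertex. Quasi-forests. A facet $F$ of $\Delta$ is a leaf if either $F$ is the only facet of $\Delta$, or there is a facet $G\ne F$ of $\Delta$ such that $F\cap H\subseteq G$ for all facets $H\neq F$ of $\Delta$. $\Delta$ is a quasi-forest if its facets can be ordered $F_1,\dots,F_q$ so that for each $i$, $F_i$ is a leaf of $\langle F_1,\dots,F_i\rangle$. Stanley–Reisner correspondence and Alexander duality. Let $V=\{x_1,\dots,x_n\}$. For a simplicial complex $\Delta$ on $V$, $\mathcal{N}(\Delta)\subseteq S$ is the squarefree monomial ideal generated by the monomials $x_{i_1}\cdots x_{i_p}$ with $\{x_{i_1},\dots,x_{i_p}\}\notin\Delta$. For a squarefree monomial ideal $I$, $\mathcal{N}(I)=\{\{x_{i_1},\dots,x_{i_p}\} : x_{i_1}\cdots x_{i_p}\notin I\}$.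 The Alexander dual of $\Delta$ is $\Delta^\vee=\{V\setminus\tau : \tau\subseteq V,\ \tau\notin\Delta\}$, and the Alexander dual of $I$ is $I^\vee=\mathcal{N}\big((\mathcal{N}(I))^\vee\big)$. Resolutions. A free resolution $\mathbf F$ of an $S$-module is minimal if $\partial_{i+1}(F_{i+1})\subseteq \mathbf{m}F_i$ for all $i\ge 0$, where $\mathbf m=(x_1,\dots,x_n)$. $\mathrm{pd}_S(I)$ is the projective dimension of $I$ as an $S$-module. Resolutions supported on a tree. Let $m_1,\dots,m_r$ be the minimal monomial generators of $I$, and let $T$ be a tree (connected acyclic graph) with $r$ vertices $v_1,\dots,v_r$, where $v_i$ is labeled by $m_i$. The associated complex ($I$-homogenization of the augmented simplicial chain complex of $T$ over $k$) is $$0\to\bigoplus_{\{v_i,v_j\}\text{ edge of }T} S\,e_{ij}\ \xrightarrow{d_2}\ \bigoplus_{i=1}^r S\,e_i\ \xrightarrow{d_1}\ S\to 0,$$ with $d_1(e_i)=m_i$ and, for each edge $\{v_i,v_j\}$ with $i<j$, $d_2(e_{ij})=\frac{\mathrm{lcm}(m_i,m_j)}{m_i}e_i-\frac{\mathrm{lcm}(m_i,m_j)}{m_j}e_j$. One says $S/I$ has a (minimal) free resolution supported on a tree if for some such labeled tree $T$ this complex is a (minimal) free resolution of $S/I$. *)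

theory Defs
  imports "HOL-Library.Poly_Mapping" "HOL-Library.Extended_Nat" "HOL-Library.Infinite_Typeclass"
begin

section \<open>Modules over a commutative ring\<close>

text \<open>A module over the ring \<open>'a\<close> is a scalar multiplication \<open>s\<close> satisfying the locale
  \<^locale>\<open>module\<close> together with a carrier that is a \<^const>\<open>module.subspace\<close>.
  Ideals of \<open>'a\<close> are the subspaces for \<open>(*)\<close>, and \<open>'b \<Rightarrow>\<^sub>0 'a\<close> is
  the free module with basis \<open>'b\<close>.\<close>

definition fscale :: "'a::comm_ring_1 \<Rightarrow> ('b \<Rightarrow>\<^sub>0 'a) \<Rightarrow> ('b \<Rightarrow>\<^sub>0 'a)" where
  "fscale c v = Poly_Mapping.map ((*) c) v"

lemma lookup_fscale: "Poly_Mapping.lookup (fscale c v) b = c * Poly_Mapping.lookup v b"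
  unfolding fscale_def by transfer (simp add: when_def)

lemma module_fscale: "module (fscale :: 'a::comm_ring_1 \<Rightarrow> ('b \<Rightarrow>\<^sub>0 'a) \<Rightarrow> _)"
  by standard (simp_all add: poly_mapping_eq_iff fun_eq_iff lookup_fscale lookup_add algebra_simps)

lemma module_mult: "module ((*) :: 'a::comm_ring_1 \<Rightarrow> 'a \<Rightarrow> 'a)"
  by standard (simp_all add: algebra_simps)

abbreviation ideal_gen :: "'a::comm_ring_1 set \<Rightarrow> 'a set" where
  "ideal_gen \<equiv> module.span (*)"

definition free_on :: "'b set \<Rightarrow> ('b \<Rightarrow>\<^sub>0 'a::comm_ring_1) set" where
  "free_on B = {v. Poly_Mapping.keys v \<subseteq> B}"

definition ideal_times ::
  "('a::comm_ring_1 \<Rightarrow> 'b::ab_group_add \<Rightarrow> 'b) \<Rightarrow> 'a set \<Rightarrow> 'b set \<Rightarrow> 'b set" where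
  "ideal_times s J M = module.span s {s a v | a v. a \<in> J \<and> v \<in> M}"

definition linear_between ::
  "('a::comm_ring_1 \<Rightarrow> 'b::ab_group_add \<Rightarrow> 'b) \<Rightarrow> 'b set \<Rightarrow>
   ('a \<Rightarrow> 'c::ab_group_add \<Rightarrow> 'c) \<Rightarrow> 'c set \<Rightarrow> ('b \<Rightarrow> 'c) \<Rightarrow> bool" where
  "linear_between s M t N f \<longleftrightarrow>
     f ` M \<subseteq> N \<and>
     (\<forall>x\<in>M. \<forall>y\<in>M. f (x + y) = f x + f y) \<and>
     (\<forall>a. \<forall>x\<in>M. f (s a x) = t a (f x))"

text \<open>A module is projective iff it is (up to isomorphism) a direct summand of a free module.
  The free module with basis the underlying type of the module itself always suffices, so
  fixing it here loses no generality.\<close>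

definition projective :: "('a::comm_ring_1 \<Rightarrow> 'b::ab_group_add \<Rightarrow> 'b) \<Rightarrow> 'b set \<Rightarrow> bool" where
  "projective s P \<longleftrightarrow>
     (\<exists>(\<iota> :: 'b \<Rightarrow> ('b \<Rightarrow>\<^sub>0 'a)) \<pi>.
        linear_between s P fscale UNIV \<iota> \<and> linear_between fscale UNIV s P \<pi> \<and>
        (\<forall>p\<in>P. \<pi> (\<iota> p) = p))"

text \<open>Resolutions \<open>\<dots> \<rightarrow> P 2 \<rightarrow> P 1 \<rightarrow> P 0 \<rightarrow> M \<rightarrow> 0\<close> with differentials
  \<open>d (i + 1) : P (i + 1) \<rightarrow> P i\<close> and augmentation \<open>\<epsilon>\<close>. A projective module with a generating
  set no larger than \<open>'u\<close> is isomorphic to a submodule of \<open>'u \<Rightarrow>\<^sub>0 'a\<close>; so the type \<open>'u\<close>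
  bounds the size of the modules that may occur in a resolution.\<close>

definition projective_resolution ::
  "('a::comm_ring_1 \<Rightarrow> 'b::ab_group_add \<Rightarrow> 'b) \<Rightarrow> 'b set \<Rightarrow>
   (nat \<Rightarrow> ('u \<Rightarrow>\<^sub>0 'a) set) \<Rightarrow> (nat \<Rightarrow> ('u \<Rightarrow>\<^sub>0 'a) \<Rightarrow> ('u \<Rightarrow>\<^sub>0 'a)) \<Rightarrow>
   (('u \<Rightarrow>\<^sub>0 'a) \<Rightarrow> 'b) \<Rightarrow> bool" where
  "projective_resolution s M P d \<epsilon> \<longleftrightarrow>
     (\<forall>i. module.subspace fscale (P i) \<and> projective fscale (P i)) \<and>
     linear_between fscale (P 0) s M \<epsilon> \<and>
     (\<forall>i. linear_between fscale (P (i + 1)) fscale (P i) (d (i + 1))) \<and>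
     \<epsilon> ` P 0 = M \<and>
     d 1 ` P 1 = {x \<in> P 0. \<epsilon> x = 0} \<and>
     (\<forall>i\<ge>1. d (i + 1) ` P (i + 1) = {x \<in> P i. d i x = 0})"

definition proj_dim ::
  "'u itself \<Rightarrow> ('a::comm_ring_1 \<Rightarrow> 'b::ab_group_add \<Rightarrow> 'b) \<Rightarrow> 'b set \<Rightarrow> enat" where
  "proj_dim _ s M =
     Inf {enat l | l. \<exists>(P :: nat \<Rightarrow> ('u \<Rightarrow>\<^sub>0 'a) set) d \<epsilon>.
            projective_resolution s M P d \<epsilon> \<and> (\<forall>i>l. P i = {0})}"


section \<open>Monomials and monomial ideals\<close>

text \<open>The polynomial ring over \<open>'k\<close> with variables \<open>'x\<close> is \<open>('x \<Rightarrow>\<^sub>0 nat) \<Rightarrow>\<^sub>0 'k\<close>;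
  a monomial is given by its exponent vector in \<open>'x \<Rightarrow>\<^sub>0 nat\<close>.\<close>

definition monomial :: "('x \<Rightarrow>\<^sub>0 nat) \<Rightarrow> (('x \<Rightarrow>\<^sub>0 nat) \<Rightarrow>\<^sub>0 'k::field)" where
  "monomial t = Poly_Mapping.single t 1"

definition var :: "'x \<Rightarrow> (('x \<Rightarrow>\<^sub>0 nat) \<Rightarrow>\<^sub>0 'k::field)" where
  "var x = monomial (Poly_Mapping.single x 1)"

definition max_ideal :: "(('x \<Rightarrow>\<^sub>0 nat) \<Rightarrow>\<^sub>0 'k::field) set" where
  "max_ideal = ideal_gen {var x | x. True}"

lift_definition lcm_exp :: "('x \<Rightarrow>\<^sub>0 nat) \<Rightarrow> ('x \<Rightarrow>\<^sub>0 nat) \<Rightarrow> ('x \<Rightarrow>\<^sub>0 nat)" is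
  "\<lambda>s t x. max (s x) (t x)"
proof -
  fix s t :: "'x \<Rightarrow> nat"
  assume "finite {x. s x \<noteq> 0}" "finite {x. t x \<noteq> 0}"
  then have "finite ({x. s x \<noteq> 0} \<union> {x. t x \<noteq> 0})" by simp
  then show "finite {x. max (s x) (t x) \<noteq> 0}"
    by (rule finite_subset[rotated]) (auto simp: max_def)
qed

definition minimal_monomial_generators ::
  "(('x \<Rightarrow>\<^sub>0 nat) \<Rightarrow>\<^sub>0 'k::field) set \<Rightarrow> ('x \<Rightarrow>\<^sub>0 nat) set \<Rightarrow> bool" where
  "minimal_monomial_generators I G \<longleftrightarrow>
     ideal_gen (monomial ` G) = I \<and> (\<forall>H. H \<subset> G \<longrightarrow> ideal_gen (monomial ` H) \<noteq> I)"

definition sqfree_monomial :: "'x::finite set \<Rightarrow> (('x \<Rightarrow>\<^sub>0 nat) \<Rightarrow>\<^sub>0 'k::field)" where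
  "sqfree_monomial \<sigma> = (\<Prod>x\<in>\<sigma>. var x)"

definition sqfree_monomial_ideal :: "(('x::finite \<Rightarrow>\<^sub>0 nat) \<Rightarrow>\<^sub>0 'k::field) set \<Rightarrow> bool" where
  "sqfree_monomial_ideal I \<longleftrightarrow> (\<exists>A. I = ideal_gen (sqfree_monomial ` A))"


section \<open>Simplicial complexes\<close>

definition facets :: "'v set set \<Rightarrow> 'v set set" where
  "facets \<Delta> = {F \<in> \<Delta>. \<forall>G\<in>\<Delta>. F \<subseteq> G \<longrightarrow> G = F}"

definition complex_generated :: "'v set set \<Rightarrow> 'v set set" where
  "complex_generated \<F> = {\<sigma>. \<exists>F\<in>\<F>. \<sigma> \<subseteq> F}"

definition leaf :: "'v set \<Rightarrow> 'v set set \<Rightarrow> bool" where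
  "leaf F \<Delta> \<longleftrightarrow> F \<in> facets \<Delta> \<and>
     (facets \<Delta> = {F} \<or>
      (\<exists>G\<in>facets \<Delta>. G \<noteq> F \<and> (\<forall>H\<in>facets \<Delta>. H \<noteq> F \<longrightarrow> F \<inter> H \<subseteq> G)))"

definition quasi_forest :: "'v set set \<Rightarrow> bool" where
  "quasi_forest \<Delta> \<longleftrightarrow>
     (\<exists>Fs. distinct Fs \<and> set Fs = facets \<Delta> \<and>
        (\<forall>i<length Fs. leaf (Fs ! i) (complex_generated (set (take (Suc i) Fs)))))"

text \<open>The ground set is the whole type of variables; \<open>sr_ideal\<close> and \<open>sr_complex\<close> are the two
  directions of the Stanley--Reisner correspondence.\<close>

definition sr_ideal :: "'x::finite set set \<Rightarrow> (('x \<Rightarrow>\<^sub>0 nat) \<Rightarrow>\<^sub>0 'k::field) set" where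
  "sr_ideal \<Delta> = ideal_gen {sqfree_monomial \<sigma> | \<sigma>. \<sigma> \<notin> \<Delta>}"

definition sr_complex :: "(('x::finite \<Rightarrow>\<^sub>0 nat) \<Rightarrow>\<^sub>0 'k::field) set \<Rightarrow> 'x set set" where
  "sr_complex I = {\<sigma>. sqfree_monomial \<sigma> \<notin> I}"

definition alexander_dual_complex :: "'x::finite set set \<Rightarrow> 'x set set" where
  "alexander_dual_complex \<Delta> = {UNIV - \<tau> | \<tau>. \<tau> \<notin> \<Delta>}"

definition alexander_dual_ideal ::
  "(('x::finite \<Rightarrow>\<^sub>0 nat) \<Rightarrow>\<^sub>0 'k::field) set \<Rightarrow> (('x \<Rightarrow>\<^sub>0 nat) \<Rightarrow>\<^sub>0 'k) set" where
  "alexander_dual_ideal I = sr_ideal (alexander_dual_complex (sr_complex I))"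


section \<open>Resolutions supported on a tree\<close>

definition is_tree :: "'v set \<Rightarrow> 'v set set \<Rightarrow> bool" where
  "is_tree V E \<longleftrightarrow>
     V \<noteq> {} \<and> (\<forall>e\<in>E. e \<subseteq> V \<and> card e = 2) \<and>
     (\<forall>u\<in>V. \<forall>v\<in>V. (u, v) \<in> {(a, b). {a, b} \<in> E}\<^sup>*) \<and>
     \<not> (\<exists>c. length c \<ge> 3 \<and> distinct c \<and>
          (\<forall>i<length c. {c ! i, c ! (Suc i mod length c)} \<in> E))"

text \<open>The vertices are natural numbers, and \<open>m i\<close> is the exponent vector of the monomial
  labelling vertex \<open>i\<close>. The basis element \<open>e\<^sub>i\<^sub>j\<close> of an edge is indexed by the pair
  \<open>(i, j)\<close> with \<open>i < j\<close>, and \<open>lcm (m\<^sub>i, m\<^sub>j) / m\<^sub>i\<close> has exponent vector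
  \<open>lcm_exp (m i) (m j) - m i\<close>.\<close>

definition oriented_edges :: "nat set set \<Rightarrow> (nat \<times> nat) set" where
  "oriented_edges E = {(i, j). i < j \<and> {i, j} \<in> E}"

definition tree_d1 ::
  "(nat \<Rightarrow> ('x \<Rightarrow>\<^sub>0 nat)) \<Rightarrow> (nat \<Rightarrow>\<^sub>0 (('x \<Rightarrow>\<^sub>0 nat) \<Rightarrow>\<^sub>0 'k::field)) \<Rightarrow>
   (('x \<Rightarrow>\<^sub>0 nat) \<Rightarrow>\<^sub>0 'k)" where
  "tree_d1 m v = (\<Sum>i\<in>Poly_Mapping.keys v. Poly_Mapping.lookup v i * monomial (m i))"

definition tree_d2 ::
  "(nat \<Rightarrow> ('x \<Rightarrow>\<^sub>0 nat)) \<Rightarrow> (nat \<times> nat \<Rightarrow>\<^sub>0 (('x \<Rightarrow>\<^sub>0 nat) \<Rightarrow>\<^sub>0 'k::field)) \<Rightarrow>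
   (nat \<Rightarrow>\<^sub>0 (('x \<Rightarrow>\<^sub>0 nat) \<Rightarrow>\<^sub>0 'k))" where
  "tree_d2 m w =
     (\<Sum>(i, j)\<in>Poly_Mapping.keys w. fscale (Poly_Mapping.lookup w (i, j))
        (Poly_Mapping.single i (monomial (lcm_exp (m i) (m j) - m i)) -
         Poly_Mapping.single j (monomial (lcm_exp (m i) (m j) - m j))))"

text \<open>Exactness of \<open>0 \<rightarrow> F\<^sub>2 \<rightarrow> F\<^sub>1 \<rightarrow> S\<close> with cokernel \<open>S/I\<close>.\<close>

definition tree_resolves ::
  "nat set \<Rightarrow> nat set set \<Rightarrow> (nat \<Rightarrow> ('x \<Rightarrow>\<^sub>0 nat)) \<Rightarrow> (('x \<Rightarrow>\<^sub>0 nat) \<Rightarrow>\<^sub>0 'k::field) set \<Rightarrow> bool"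
  where
  "tree_resolves V E m I \<longleftrightarrow>
     inj_on (tree_d2 m ::
       (nat \<times> nat \<Rightarrow>\<^sub>0 (('x \<Rightarrow>\<^sub>0 nat) \<Rightarrow>\<^sub>0 'k)) \<Rightarrow> _) (free_on (oriented_edges E)) \<and>
     tree_d2 m ` free_on (oriented_edges E) =
       {v \<in> free_on V. tree_d1 m v = (0 :: ('x \<Rightarrow>\<^sub>0 nat) \<Rightarrow>\<^sub>0 'k)} \<and>
     tree_d1 m ` free_on V = I"

definition tree_minimal ::
  "'k::field itself \<Rightarrow> nat set \<Rightarrow> nat set set \<Rightarrow> (nat \<Rightarrow> ('x \<Rightarrow>\<^sub>0 nat)) \<Rightarrow> bool" where
  "tree_minimal _ V E m \<longleftrightarrow>
     tree_d1 m ` free_on V \<subseteq>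
       ideal_times (*) (max_ideal :: (('x \<Rightarrow>\<^sub>0 nat) \<Rightarrow>\<^sub>0 'k) set) UNIV \<and>
     tree_d2 m ` free_on (oriented_edges E) \<subseteq>
       ideal_times fscale (max_ideal :: (('x \<Rightarrow>\<^sub>0 nat) \<Rightarrow>\<^sub>0 'k) set) (free_on V)"

definition minimal_resolution_supported_on_tree ::
  "(('x \<Rightarrow>\<^sub>0 nat) \<Rightarrow>\<^sub>0 'k::field) set \<Rightarrow> bool" where
  "minimal_resolution_supported_on_tree I \<longleftrightarrow>
     (\<exists>r m E. inj_on m {1..r} \<and> minimal_monomial_generators I (m ` {1..r}) \<and>
        is_tree {1..r} E \<and> tree_resolves {1..r} E m I \<and> tree_minimal TYPE('k) {1..r} E m)"

end

theory Submission
  imports Defs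
begin

text \<open>All three statements are compared with one combinatorial condition on the minimal monomial
generators: they can be listed as \<open>t\<^sub>0, t\<^sub>1, \<dots>\<close> so that each \<open>t\<^sub>i\<close> with \<open>i > 0\<close> has a predecessor
\<open>t\<^sub>j\<close> dividing \<open>lcm t\<^sub>i t\<^sub>h\<close> for all \<open>h < i\<close> (\<open>lcm_elim_order\<close>). The facets of
\<open>\<N>(I\<^sup>\<or>)\<close> are the complements of the supports of the generators, and complementation turns
\<open>F\<^sub>i \<inter> F\<^sub>h \<subseteq> F\<^sub>j\<close> into \<open>t\<^sub>j | lcm t\<^sub>i t\<^sub>h\<close>, so such a list is the same thing as a leaf order of a
quasi-forest (\<open>quasi_forest_dual_iff_elim_order\<close>).

From a list to a tree: join each \<open>t\<^sub>i\<close> to its predecessor \<open>t\<^sub>j\<close>. A syzygy is killed from its last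
coordinate downwards, because each term of that coordinate is a multiple of \<open>lcm t\<^sub>i t\<^sub>h / t\<^sub>i\<close>
for some \<open>h\<close>, hence of \<open>lcm t\<^sub>i t\<^sub>j / t\<^sub>i\<close> (\<open>kernel_in_image_if_elimination\<close>). The matrix of
\<open>d\<^sub>2\<close> is triangular, so \<open>d\<^sub>2\<close> is injective.

From a tree to a list: exactness says that two vertices are always joined by a path all of whose
labels divide their lcm (\<open>connected_below_lcm\<close>), and injectivity says that every edge is a bridge
(\<open>bridge_if_inj\<close>). When a connected set of vertices is enlarged by a neighbour \<open>i\<close> of a member
\<open>p\<close>, each path from \<open>i\<close> into the set runs through \<open>p\<close>, so \<open>p\<close> can serve as the predecessor of
\<open>i\<close> (\<open>elim_order_if_tree_resolves\<close>). The same two facts show that exactness makes a graph a tree.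

A tree resolution is a free resolution of length one of \<open>I\<close>, so \<open>pd I \<le> 1\<close>. Conversely,
choose a smallest set of pairs of generators whose syzygies generate the first syzygy module
\<open>K\<close>. If \<open>pd I \<le> 1\<close>, then \<open>K\<close> is projective, in the form that \<open>d\<^sub>2\<close> has a section over \<open>K\<close>
(\<open>section_if_projective_resolution\<close>), and \<open>ker d\<^sub>2\<close> is a direct summand of the free module on the
pairs. Minimality puts this summand inside \<open>\<m>\<close> times the free module
(\<open>syz_redundant_if_unit_coefficient\<close>), hence inside all powers of \<open>\<m>\<close>, so it vanishes
(\<open>idempotent_into_max_ideal_eq_0\<close>). Thus \<open>d\<^sub>2\<close> is injective, the complex is exact, and the chosen
pairs are the edges of a tree.\<close>

section \<open>Linear extension and lifting through projective modules\<close>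

text \<open>Both differentials of a tree complex have this form; working with it lets the linear algebra be
done once.\<close>

definition lin_ext ::
  "('a::comm_ring_1 \<Rightarrow> 'b::ab_group_add \<Rightarrow> 'b) \<Rightarrow> ('c \<Rightarrow> 'b) \<Rightarrow> ('c \<Rightarrow>\<^sub>0 'a) \<Rightarrow> 'b" where
  "lin_ext s h v = (\<Sum>c\<in>Poly_Mapping.keys v. s (Poly_Mapping.lookup v c) (h c))"

abbreviation basis_vec :: "'c \<Rightarrow> ('c \<Rightarrow>\<^sub>0 'a::comm_ring_1)" where
  "basis_vec c \<equiv> Poly_Mapping.single c 1"

text \<open>Summing over a common superset of the supports is what makes additivity visible.\<close>

lemma lin_ext_superset:
  assumes "module s" "finite A" "Poly_Mapping.keys v \<subseteq> A"
  shows "lin_ext s h v = (\<Sum>c\<in>A. s (Poly_Mapping.lookup v c) (h c))"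
proof -
  interpret module s by fact
  show ?thesis unfolding lin_ext_def using assms(2,3)
    by (intro sum.mono_neutral_left) (auto simp: not_in_keys_iff_lookup_eq_zero)
qed

lemma module_hom_lin_ext:
  fixes s :: "'a::comm_ring_1 \<Rightarrow> 'b::ab_group_add \<Rightarrow> 'b" and h :: "'c \<Rightarrow> 'b"
  assumes "module s"
  shows "module_hom fscale s (lin_ext s h)"
proof -
  interpret M: module s by fact
  interpret F: module fscale by (rule module_fscale)
  show ?thesis
  proof
    fix x y :: "'c \<Rightarrow>\<^sub>0 'a"
    let ?A = "Poly_Mapping.keys x \<union> Poly_Mapping.keys y"
    show "lin_ext s h (x + y) = lin_ext s h x + lin_ext s h y"
      using Poly_Mapping.keys_add[of x y]
      by (simp add: lin_ext_superset[OF assms, of ?A] lookup_add M.scale_left_distrib sum.distrib)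
  next
    fix r and x :: "'c \<Rightarrow>\<^sub>0 'a"
    have "Poly_Mapping.keys (fscale r x) \<subseteq> Poly_Mapping.keys x"
      by (auto simp: in_keys_iff lookup_fscale)
    then show "lin_ext s h (fscale r x) = s r (lin_ext s h x)"
      by (simp add: lin_ext_superset[OF assms, of "Poly_Mapping.keys x"] lookup_fscale M.scale_sum_right)
  qed
qed

lemma lin_ext_single:
  assumes "module s"
  shows "lin_ext s h (Poly_Mapping.single c a) = s a (h c)"
  using lin_ext_superset[OF assms, of "{c}" "Poly_Mapping.single c a" h]
  by (cases "a = 0") simp_all

lemma lin_ext_basis_vec: "lin_ext fscale basis_vec v = v"
proof (rule poly_mapping_eqI)
  fix i
  have "Poly_Mapping.lookup (lin_ext fscale basis_vec v) i =
      (\<Sum>c\<in>Poly_Mapping.keys v. if c = i then Poly_Mapping.lookup v c else 0)"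
    unfolding lin_ext_def lookup_sum
    by (intro sum.cong) (auto simp: lookup_fscale lookup_single)
  also have "\<dots> = Poly_Mapping.lookup v i"
    by (simp add: sum.delta in_keys_iff)
  finally show "Poly_Mapping.lookup (lin_ext fscale basis_vec v) i = Poly_Mapping.lookup v i" .
qed

lemma lin_ext_mem:
  assumes "module s" "module.subspace s M" "v \<in> free_on B" "\<And>b. b \<in> B \<Longrightarrow> h b \<in> M"
  shows "lin_ext s h v \<in> M"
proof -
  interpret module s by fact
  show ?thesis unfolding lin_ext_def using assms(2-4)
    by (intro subspace_sum) (auto simp: free_on_def intro!: subspace_scale)
qed

lemma linear_between_sum:
  assumes "linear_between s M t N f" "module s" "module t" "module.subspace s M"
    "\<And>i. i \<in> A \<Longrightarrow> x i \<in> M"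
  shows "f (sum x A) = (\<Sum>i\<in>A. f (x i))"
proof -
  interpret S: module s by fact
  interpret T: module t by fact
  have "f (s 0 0) = t 0 (f 0)"
    using assms(1) S.subspace_0[OF assms(4)] unfolding linear_between_def by blast
  then have 0: "f 0 = 0" by simp
  show ?thesis using assms(5)
  proof (induction A rule: infinite_finite_induct)
    case (insert a A)
    then have "sum x A \<in> M" using assms(4) by (intro S.subspace_sum) auto
    with insert assms(1) show ?case unfolding linear_between_def by auto
  qed (use 0 in auto)
qed

lemma linear_between_lin_ext:
  assumes "linear_between s M t N f" "module s" "module t" "module.subspace s M"
    "v \<in> free_on B" "\<And>b. b \<in> B \<Longrightarrow> h b \<in> M"
  shows "f (lin_ext s h v) = lin_ext t (\<lambda>b. f (h b)) v"
proof -
  interpret S: module s by fact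
  have "f (lin_ext s h v) = (\<Sum>c\<in>Poly_Mapping.keys v. f (s (Poly_Mapping.lookup v c) (h c)))"
    unfolding lin_ext_def using assms(4-6)
    by (intro linear_between_sum[OF assms(1-4)] S.subspace_scale) (auto simp: free_on_def)
  also have "\<dots> = lin_ext t (\<lambda>b. f (h b)) v"
    unfolding lin_ext_def using assms(1,5,6)
    by (intro sum.cong) (auto simp: linear_between_def free_on_def)
  finally show ?thesis .
qed

lemma linear_between_0:
  assumes "linear_between s M t N f" "module s" "module t" "module.subspace s M"
  shows "f 0 = 0"
  using linear_between_sum[OF assms, of "{}"] by simp

lemma linear_between_diff:
  assumes "linear_between s M t N f" "module s" "module t" "module.subspace s M" "x \<in> M" "y \<in> M"
  shows "f (x - y) = f x - f y"
proof -
  interpret S: module s by fact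
  have "f (x - y + y) = f (x - y) + f y"
    using assms(1,6) S.subspace_diff[OF assms(4-6)] unfolding linear_between_def by blast
  then show ?thesis by (simp add: algebra_simps)
qed

lemma module_hom_imp_linear_between:
  assumes "module_hom s t f" "f ` M \<subseteq> N"
  shows "linear_between s M t N f"
proof -
  interpret module_hom s t f by fact
  show ?thesis using assms(2) by (auto simp: linear_between_def add scale)
qed

lemma linear_between_comp:
  "linear_between s M t N f \<Longrightarrow> linear_between t N u K g \<Longrightarrow> linear_between s M u K (\<lambda>x. g (f x))"
  by (auto simp: linear_between_def image_subset_iff)

lemma subspace_free_on: "module.subspace fscale (free_on B)"
proof -
  interpret F: module fscale by (rule module_fscale)
  show ?thesis
  proof (rule F.subspaceI)
    show "x + y \<in> free_on B" if "x \<in> free_on B" "y \<in> free_on B" for x y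
      using that Poly_Mapping.keys_add[of x y] by (auto simp: free_on_def)
    show "fscale c x \<in> free_on B" if "x \<in> free_on B" for c x
      using that mult_zero_right by (fastforce simp: free_on_def in_keys_iff lookup_fscale)
  qed (simp add: free_on_def)
qed

lemma free_on_UNIV [simp]: "free_on UNIV = UNIV"
  by (simp add: free_on_def)

lemma basis_vec_in_free_on: "b \<in> B \<Longrightarrow> basis_vec b \<in> free_on B"
  by (auto simp: free_on_def)

text \<open>This turns images of the differentials into spans, so that generators can be exchanged.\<close>

lemma lin_ext_image:
  assumes "module s"
  shows "lin_ext s h ` free_on B = module.span s (h ` B)"
proof -
  interpret M: module s by fact
  show ?thesis
  proof (intro antisym subsetI)
    fix y assume "y \<in> lin_ext s h ` free_on B"
    then obtain v where v: "v \<in> free_on B" "y = lin_ext s h v" by blast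
    have "lin_ext s h v \<in> M.span (h ` B)"
      by (rule lin_ext_mem[OF assms M.subspace_span v(1)]) (auto intro: M.span_base)
    with v(2) show "y \<in> M.span (h ` B)" by simp
  next
    interpret module_hom fscale s "lin_ext s h" by (rule module_hom_lin_ext[OF assms])
    have "h ` B \<subseteq> lin_ext s h ` free_on B"
    proof
      fix y assume "y \<in> h ` B"
      then obtain b where "b \<in> B" "y = h b" by blast
      then have "y = lin_ext s h (basis_vec b)" by (simp add: lin_ext_single[OF assms])
      with \<open>b \<in> B\<close> show "y \<in> lin_ext s h ` free_on B"
        by (intro image_eqI[of _ _ "basis_vec b"] basis_vec_in_free_on)
    qed
    then have "M.span (h ` B) \<subseteq> lin_ext s h ` free_on B"
      by (rule M.span_minimal) (rule subspace_image[OF subspace_free_on])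
    then show "y \<in> lin_ext s h ` free_on B" if "y \<in> M.span (h ` B)" for y using that by blast
  qed
qed

text \<open>A preimage is chosen for each basis vector; uniqueness of linear extension does the rest.\<close>

lemma linear_between_free_lift:
  assumes "module u" "module t" "module.subspace t A" "linear_between t A u N q"
    "linear_between fscale UNIV u N f" "f ` UNIV \<subseteq> q ` A"
  shows "\<exists>g. linear_between fscale UNIV t A g \<and> (\<forall>v. q (g v) = f v)"
proof -
  have "\<forall>b. \<exists>a\<in>A. q a = f (basis_vec b)"
  proof
    fix b
    have "f (basis_vec b) \<in> q ` A" using assms(6) by blast
    then show "\<exists>a\<in>A. q a = f (basis_vec b)" by (metis imageE)
  qed
  then obtain h where h: "\<And>b. h b \<in> A" "\<And>b. q (h b) = f (basis_vec b)" by metis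
  have "linear_between fscale UNIV t A (lin_ext t h)"
    using h(1) assms(2,3)
    by (intro module_hom_imp_linear_between module_hom_lin_ext) (auto intro!: lin_ext_mem[where B=UNIV])
  moreover have "q (lin_ext t h v) = f v" for v
  proof -
    have "q (lin_ext t h v) = lin_ext u (\<lambda>b. f (basis_vec b)) v"
      using linear_between_lin_ext[OF assms(4,2,1,3), of v UNIV h] h by simp
    also have "\<dots> = f (lin_ext fscale basis_vec v)"
      using linear_between_lin_ext[OF assms(5) module_fscale assms(1), of v UNIV basis_vec]
      by (simp add: module.subspace_UNIV[OF module_fscale])
    finally show ?thesis by (simp add: lin_ext_basis_vec)
  qed
  ultimately show ?thesis by blast
qed

text \<open>The identity of \<open>P\<close> factors through a free module as \<open>\<pi> \<circ> \<iota>\<close>; lift \<open>f \<circ> \<pi>\<close> there and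
restrict the lift along \<open>\<iota>\<close>.\<close>

lemma projective_lift:
  fixes s :: "'a::comm_ring_1 \<Rightarrow> 'b::ab_group_add \<Rightarrow> 'b" and P :: "'b set"
    and t :: "'a \<Rightarrow> 'c::ab_group_add \<Rightarrow> 'c" and u :: "'a \<Rightarrow> 'd::ab_group_add \<Rightarrow> 'd"
  assumes "projective s P" "module s" "module.subspace s P"
    "module u" "module t" "module.subspace t A" "linear_between t A u N q"
    "linear_between s P u N f" "f ` P \<subseteq> q ` A"
  shows "\<exists>g. linear_between s P t A g \<and> (\<forall>p\<in>P. q (g p) = f p)"
proof -
  obtain \<iota> :: "'b \<Rightarrow> ('b \<Rightarrow>\<^sub>0 'a)" and \<pi> where \<iota>: "linear_between s P fscale UNIV \<iota>" and \<pi>: "linear_between fscale UNIV s P \<pi>"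
    and id: "\<forall>p\<in>P. \<pi> (\<iota> p) = p"
    using assms(1) unfolding projective_def by blast
  have "range (\<lambda>v. f (\<pi> v)) \<subseteq> q ` A"
    using \<pi> assms(9) by (auto simp: linear_between_def image_subset_iff)
  then obtain g where g: "linear_between fscale UNIV t A g" "\<forall>v. q (g v) = f (\<pi> v)"
    using linear_between_free_lift[OF assms(4-7) linear_between_comp[OF \<pi> assms(8)]] by blast
  show ?thesis
    using linear_between_comp[OF \<iota> g(1)] g(2) id by (intro exI[of _ "\<lambda>p. g (\<iota> p)"]) auto
qed

text \<open>\<open>\<iota>\<close> sends a basis vector to the basis vector indexed by it, and \<open>\<pi>\<close> evaluates formal
combinations of elements of the module; indices outside the carrier must go to \<open>0\<close>, for \<open>\<pi>\<close> to
stay inside it.\<close>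

lemma projective_free_on: "projective fscale (free_on B :: ('b \<Rightarrow>\<^sub>0 'a::comm_ring_1) set)"
proof -
  let ?P = "free_on B :: ('b \<Rightarrow>\<^sub>0 'a) set"
  define \<iota> :: "('b \<Rightarrow>\<^sub>0 'a) \<Rightarrow> (('b \<Rightarrow>\<^sub>0 'a) \<Rightarrow>\<^sub>0 'a)" where "\<iota> = lin_ext fscale (\<lambda>b. basis_vec (basis_vec b))"
  define \<pi> :: "(('b \<Rightarrow>\<^sub>0 'a) \<Rightarrow>\<^sub>0 'a) \<Rightarrow> ('b \<Rightarrow>\<^sub>0 'a)" where "\<pi> = lin_ext fscale (\<lambda>p. if p \<in> ?P then p else 0)"
  have \<iota>: "linear_between fscale ?P fscale UNIV \<iota>" unfolding \<iota>_def
    by (intro module_hom_imp_linear_between module_hom_lin_ext module_fscale) auto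
  have "lin_ext fscale (\<lambda>p. if p \<in> ?P then p else 0) v \<in> ?P" for v :: "('b \<Rightarrow>\<^sub>0 'a) \<Rightarrow>\<^sub>0 'a"
    by (rule lin_ext_mem[OF module_fscale subspace_free_on, where B = UNIV])
       (auto simp: module.subspace_0[OF module_fscale subspace_free_on])
  then have \<pi>: "linear_between fscale UNIV fscale ?P \<pi>" unfolding \<pi>_def
    by (intro module_hom_imp_linear_between module_hom_lin_ext module_fscale) auto
  have "\<pi> (\<iota> p) = p" if "p \<in> ?P" for p
  proof -
    have "\<pi> (\<iota> p) = lin_ext fscale (\<lambda>b. \<pi> (basis_vec (basis_vec b))) p" unfolding \<iota>_def
      using linear_between_lin_ext[OF \<pi> module_fscale module_fscale, of p UNIV] 
      by (simp add: module.subspace_UNIV[OF module_fscale])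
    also have "\<dots> = lin_ext fscale basis_vec p"
      unfolding lin_ext_def using that
      by (intro sum.cong)
         (auto simp: \<pi>_def lin_ext_single[OF module_fscale] free_on_def module.scale_one[OF module_fscale])
    finally show ?thesis by (simp add: lin_ext_basis_vec)
  qed
  with \<iota> \<pi> show ?thesis unfolding projective_def by blast
qed

section \<open>Sections from projective resolutions of length one\<close>

text \<open>The infimum of a nonempty set of extended naturals is attained, and that of the empty set is
\<open>\<infinity>\<close>.\<close>

lemma proj_dim_le_1_iff:
  "proj_dim TYPE('u) s M \<le> 1 \<longleftrightarrow>
     (\<exists>(P :: nat \<Rightarrow> ('u \<Rightarrow>\<^sub>0 'a::comm_ring_1) set) d \<epsilon>.
        projective_resolution s M P d \<epsilon> \<and> (\<forall>i>1. P i = {0}))"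
  (is "_ \<longleftrightarrow> ?R")
proof
  let ?X = "{enat l | l. \<exists>(P :: nat \<Rightarrow> ('u \<Rightarrow>\<^sub>0 'a) set) d \<epsilon>.
            projective_resolution s M P d \<epsilon> \<and> (\<forall>i>l. P i = {0})}"
  assume le: "proj_dim TYPE('u) s M \<le> 1"
  have ne: "?X \<noteq> {}"
  proof
    assume e: "?X = {}"
    show False using le unfolding proj_dim_def e by (simp add: top_enat_def)
  qed
  then have "Inf ?X \<in> ?X" by (meson all_not_in_conv wellorder_InfI)
  with le have "proj_dim TYPE('u) s M \<in> ?X" by (simp only: proj_dim_def)
  then obtain l and P :: "nat \<Rightarrow> ('u \<Rightarrow>\<^sub>0 'a) set" and d \<epsilon>
    where l: "proj_dim TYPE('u) s M = enat l" "projective_resolution s M P d \<epsilon>" "\<forall>i>l. P i = {0}"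
    by blast
  then have "l \<le> 1" using le by (simp add: one_enat_def)
  then show ?R using l by (intro exI[of _ P] exI[of _ d] exI[of _ \<epsilon>]) auto
next
  assume ?R
  then show "proj_dim TYPE('u) s M \<le> 1"
    unfolding proj_dim_def one_enat_def by (intro Inf_lower) blast
qed

text \<open>The argument of Schanuel's lemma. Write \<open>S\<^sup>V\<close> for the free module with basis \<open>V\<close>.
Let \<open>K = ker f\<close>, and compare the two presentations of \<open>M\<close> by
\<open>\<phi> : P 0 \<rightarrow> S\<^sup>V\<close> and \<open>\<psi> : S\<^sup>V \<rightarrow> P 0\<close> over the identity of \<open>M\<close>. Split \<open>x \<in> K\<close> as
\<open>(x - \<phi> (\<psi> x)) + \<phi> (\<psi> x)\<close>. The first map is defined on all of \<open>S\<^sup>V\<close> with values in \<open>K\<close>, so it lifts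
through \<open>q\<close> because \<open>S\<^sup>V\<close> is free. The second one factors through \<open>ker \<epsilon> \<cong> P 1\<close>, where length
one is used, so it lifts because \<open>P 1\<close> is projective. The sum of the lifts is a section of \<open>q\<close>.\<close>

lemma section_if_projective_resolution:
  fixes s :: "'a::comm_ring_1 \<Rightarrow> 'b::ab_group_add \<Rightarrow> 'b"
    and P :: "nat \<Rightarrow> ('u \<Rightarrow>\<^sub>0 'a) set" and V :: "'v set"
    and t :: "'a \<Rightarrow> 'c::ab_group_add \<Rightarrow> 'c"
  assumes "module s" and res: "projective_resolution s M P d \<epsilon>" "\<forall>i>1. P i = {0}"
    and f: "linear_between fscale (free_on V) s M f" "f ` free_on V = M"
    and A: "module t" "module.subspace t A"
    and q: "linear_between t A fscale (free_on V) q" "q ` A = {v \<in> free_on V. f v = 0}"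
  shows "\<exists>\<sigma>. linear_between fscale {v \<in> free_on V. f v = 0} t A \<sigma> \<and>
     (\<forall>x\<in>{v \<in> free_on V. f v = 0}. q (\<sigma> x) = x)"
proof -
  interpret S: module s by fact
  interpret T: module t by fact
  interpret F: module fscale by (rule module_fscale)
  define K where "K = {v \<in> free_on V. f v = 0}"
  have P: "F.subspace (P i)" "projective fscale (P i)" for i
    using res(1) unfolding projective_resolution_def by blast+
  have \<epsilon>: "linear_between fscale (P 0) s M \<epsilon>" "\<epsilon> ` P 0 = M"
    using res(1) unfolding projective_resolution_def by blast+
  have L: "linear_between fscale (P (i + 1)) fscale (P i) (d (i + 1))" for i
    using res(1) unfolding projective_resolution_def by blast
  have "d 1 ` P 1 = {x \<in> P 0. \<epsilon> x = 0}"
    using res(1) unfolding projective_resolution_def by blast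
  with L[of 0] have d: "linear_between fscale (P 1) fscale (P 0) (d 1)" "d 1 ` P 1 = {x \<in> P 0. \<epsilon> x = 0}"
    by simp_all
  have "d (1 + 1) ` P (1 + 1) = {x \<in> P 1. d 1 x = 0}"
    using res(1) unfolding projective_resolution_def by blast
  with L[of 1] have d2: "linear_between fscale (P 2) fscale (P 1) (d 2)" "d 2 ` P 2 = {x \<in> P 1. d 1 x = 0}"
    by (simp_all add: numeral_2_eq_2)
  have d1_inj: "x = 0" if "x \<in> P 1" "d 1 x = 0" for x
  proof -
    have "P 2 = {0}" using res(2) by simp
    then have "d 2 ` P 2 = {0}"
      using linear_between_0[OF d2(1) module_fscale module_fscale P(1)] by simp
    with that d2(2) show ?thesis by auto
  qed
  have V: "F.subspace (free_on V)" by (rule subspace_free_on)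
  obtain \<phi> where \<phi>: "linear_between fscale (P 0) fscale (free_on V) \<phi>" "\<And>x. x \<in> P 0 \<Longrightarrow> f (\<phi> x) = \<epsilon> x"
    using projective_lift[OF P(2) module_fscale P(1) \<open>module s\<close> module_fscale V f(1) \<epsilon>(1)] f(2) \<epsilon>(2)
    by blast
  obtain \<psi> where \<psi>: "linear_between fscale (free_on V) fscale (P 0) \<psi>"
      "\<And>x. x \<in> free_on V \<Longrightarrow> \<epsilon> (\<psi> x) = f x"
    using projective_lift[OF projective_free_on module_fscale V \<open>module s\<close> module_fscale P(1) \<epsilon>(1) f(1)]
      f(2) \<epsilon>(2) by blast
  have \<phi>V: "\<phi> x \<in> free_on V" if "x \<in> P 0" for x
    using \<phi>(1) that by (auto simp: linear_between_def)
  have \<psi>P: "\<psi> x \<in> P 0" if "x \<in> free_on V" for x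
    using \<psi>(1) that by (auto simp: linear_between_def)
  have dP: "d 1 x \<in> P 0" "\<epsilon> (d 1 x) = 0" if "x \<in> P 1" for x
    using d(2) that by blast+
  have "(\<lambda>x. \<phi> (d 1 x)) ` P 1 \<subseteq> q ` A"
    unfolding q(2) using \<phi>V dP \<phi>(2) by auto
  then obtain \<theta> where \<theta>: "linear_between fscale (P 1) t A \<theta>" "\<And>x. x \<in> P 1 \<Longrightarrow> q (\<theta> x) = \<phi> (d 1 x)"
    using projective_lift[OF P(2) module_fscale P(1) module_fscale A q(1) linear_between_comp[OF d(1) \<phi>(1)]]
    by blast
  have fdiff: "f (x - \<phi> (\<psi> x)) = 0" if "x \<in> free_on V" for x
    using linear_between_diff[OF f(1) module_fscale \<open>module s\<close> V that, of "\<phi> (\<psi> x)"]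
      \<phi>V \<psi>P \<phi>(2) \<psi>(2) that by simp
  have diffV: "x - \<phi> (\<psi> x) \<in> free_on V" if "x \<in> free_on V" for x
    using F.subspace_diff[OF V that] \<phi>V \<psi>P that by blast
  have diff_lin: "linear_between fscale (free_on V) fscale (free_on V) (\<lambda>x. x - \<phi> (\<psi> x))"
    using linear_between_comp[OF \<psi>(1) \<phi>(1)] diffV
    by (simp add: linear_between_def F.scale_right_diff_distrib image_subset_iff)
  have "(\<lambda>x. x - \<phi> (\<psi> x)) ` free_on V \<subseteq> q ` A"
    unfolding q(2) using fdiff diffV by blast
  then obtain \<eta> where \<eta>: "linear_between fscale (free_on V) t A \<eta>"
      "\<And>x. x \<in> free_on V \<Longrightarrow> q (\<eta> x) = x - \<phi> (\<psi> x)"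
    using projective_lift[OF projective_free_on module_fscale V module_fscale A q(1) diff_lin]
    by blast
  \<comment> \<open>The inverse of \<open>d 1 : P 1 \<rightarrow> ker \<epsilon>\<close>, which is bijective because \<open>P 2 = {0}\<close>.\<close>
  define \<delta> where "\<delta> x = (THE y. y \<in> P 1 \<and> d 1 y = x)" for x
  have \<delta>_eq: "\<delta> (d 1 y) = y" if "y \<in> P 1" for y
    unfolding \<delta>_def
  proof (rule the_equality)
    fix y' assume y': "y' \<in> P 1 \<and> d 1 y' = d 1 y"
    then have "d 1 (y' - y) = 0" "y' - y \<in> P 1"
      using linear_between_diff[OF d(1) module_fscale module_fscale P(1), of y' y] that
        F.subspace_diff[OF P(1)] by auto
    then show "y' = y" using d1_inj[of "y' - y"] by simp
  qed (use that in simp)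
  have \<psi>_in: "\<exists>y\<in>P 1. \<psi> x = d 1 y" if "x \<in> K" for x
    using that d(2) \<psi>P \<psi>(2)[of x] by (auto simp: K_def image_iff set_eq_iff)
  have \<delta>: "linear_between fscale K fscale (P 1) (\<lambda>x. \<delta> (\<psi> x))"
    unfolding linear_between_def
  proof (intro conjI ballI allI)
    show "(\<lambda>x. \<delta> (\<psi> x)) ` K \<subseteq> P 1" using \<psi>_in \<delta>_eq by fastforce
  next
    fix x y assume xy: "x \<in> K" "y \<in> K"
    then obtain x' y' where x': "x' \<in> P 1" "\<psi> x = d 1 x'" and y': "y' \<in> P 1" "\<psi> y = d 1 y'"
      using \<psi>_in by meson
    have "\<psi> (x + y) = d 1 (x' + y')"
      using \<psi>(1) d(1) x' y' xy by (simp add: linear_between_def K_def)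
    then show "\<delta> (\<psi> (x + y)) = \<delta> (\<psi> x) + \<delta> (\<psi> y)"
      using x' y' \<delta>_eq F.subspace_add[OF P(1)] by simp
  next
    fix a x assume x: "x \<in> K"
    then obtain x' where x': "x' \<in> P 1" "\<psi> x = d 1 x'"
      using \<psi>_in by meson
    have "\<psi> (fscale a x) = d 1 (fscale a x')"
      using \<psi>(1) d(1) x' x by (simp add: linear_between_def K_def)
    then show "\<delta> (\<psi> (fscale a x)) = fscale a (\<delta> (\<psi> x))"
      using x' \<delta>_eq F.subspace_scale[OF P(1)] by simp
  qed
  define \<sigma> where "\<sigma> x = \<eta> x + \<theta> (\<delta> (\<psi> x))" for x
  have "linear_between fscale K t A \<sigma>"
    using linear_between_comp[OF \<delta> \<theta>(1)] \<eta>(1) T.subspace_add[OF A(2)]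
    by (simp add: linear_between_def \<sigma>_def K_def image_subset_iff T.scale_right_distrib)
  moreover have "q (\<sigma> x) = x" if xK: "x \<in> K" for x
  proof -
    obtain y where y: "y \<in> P 1" "\<psi> x = d 1 y" using \<psi>_in[OF xK] by blast
    have x: "x \<in> free_on V" using xK by (simp add: K_def)
    have "\<eta> x \<in> A" "\<theta> y \<in> A" using \<eta>(1) \<theta>(1) x y by (auto simp: linear_between_def)
    then have "q (\<sigma> x) = q (\<eta> x) + q (\<theta> y)"
      using q(1) y \<delta>_eq by (simp add: linear_between_def \<sigma>_def)
    also have "\<dots> = x" using \<eta>(2)[OF x] \<theta>(2)[OF y(1)] y by simp
    finally show ?thesis .
  qed
  ultimately show ?thesis unfolding K_def by blast
qed

section \<open>Exponent vectors and monomial ideals\<close>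

text \<open>Divisibility of monomials. The order that exponent vectors carry as finitely supported functions
is lexicographic, hence a different one.\<close>

definition divides_exp :: "('x \<Rightarrow>\<^sub>0 nat) \<Rightarrow> ('x \<Rightarrow>\<^sub>0 nat) \<Rightarrow> bool"  (infix "\<preceq>" 50) where
  "s \<preceq> t \<longleftrightarrow> (\<forall>x. Poly_Mapping.lookup s x \<le> Poly_Mapping.lookup t x)"

lemma divides_exp_refl [simp]: "s \<preceq> s"
  by (simp add: divides_exp_def)

lemma divides_exp_trans: "s \<preceq> t \<Longrightarrow> t \<preceq> u \<Longrightarrow> s \<preceq> u"
  unfolding divides_exp_def using order_trans by blast

lemma divides_exp_antisym: "s \<preceq> t \<Longrightarrow> t \<preceq> s \<Longrightarrow> s = t"
  by (auto simp: divides_exp_def intro!: poly_mapping_eqI order_antisym)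

lemma zero_divides_exp [simp]: "0 \<preceq> t"
  by (simp add: divides_exp_def)

lemma divides_exp_lcm_iff: "lcm_exp s t \<preceq> u \<longleftrightarrow> s \<preceq> u \<and> t \<preceq> u"
  by (auto simp: divides_exp_def lcm_exp.rep_eq)

lemma divides_exp_lcm [simp]: "s \<preceq> lcm_exp s t" "t \<preceq> lcm_exp s t"
  by (auto simp: divides_exp_def lcm_exp.rep_eq)

lemma diff_add_exp: "s \<preceq> t \<Longrightarrow> t - s + s = t"
  by (auto simp: divides_exp_def lookup_add lookup_minus intro!: poly_mapping_eqI)

lemma divides_exp_iff: "s \<preceq> t \<longleftrightarrow> (\<exists>u. t = u + s)"
proof
  show "s \<preceq> t \<Longrightarrow> \<exists>u. t = u + s" using diff_add_exp[of s t] by metis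
qed (auto simp: divides_exp_def lookup_add)

lemma divides_exp_add [simp]: "s \<preceq> t + s"
  by (auto simp: divides_exp_iff)

lemma diff_exp_divides_iff: "s \<preceq> l \<Longrightarrow> l - s \<preceq> t \<longleftrightarrow> l \<preceq> t + s"
  by (auto simp: divides_exp_def lookup_add lookup_minus le_diff_conv)

lemma divides_exp_sum: "finite A \<Longrightarrow> a \<in> A \<Longrightarrow> f a \<preceq> (\<Sum>i\<in>A. f i)"
  unfolding divides_exp_def lookup_sum
  using member_le_sum[of a A "\<lambda>i. Poly_Mapping.lookup (f i) x" for x] by auto

lemma sum_single_lookup:
  "(\<Sum>t\<in>Poly_Mapping.keys p. Poly_Mapping.single t (Poly_Mapping.lookup p t)) = p"
  by (rule poly_mapping_eqI) (auto simp: lookup_sum lookup_single when_def sum.delta in_keys_iff)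

lemma lookup_mult_monomial:
  fixes p :: "('x \<Rightarrow>\<^sub>0 nat) \<Rightarrow>\<^sub>0 'k::field"
  shows "Poly_Mapping.lookup (p * monomial u) t =
    (if u \<preceq> t then Poly_Mapping.lookup p (t - u) else 0)"
proof -
  have "p * monomial u =
      (\<Sum>k\<in>Poly_Mapping.keys p. Poly_Mapping.single k (Poly_Mapping.lookup p k)) * monomial u"
    by (simp only: sum_single_lookup)
  also have "\<dots> = (\<Sum>k\<in>Poly_Mapping.keys p. Poly_Mapping.single (k + u) (Poly_Mapping.lookup p k))"
    by (simp add: sum_distrib_right monomial_def mult_single)
  finally have "p * monomial u =
      (\<Sum>k\<in>Poly_Mapping.keys p. Poly_Mapping.single (k + u) (Poly_Mapping.lookup p k))" .
  then have *: "Poly_Mapping.lookup (p * monomial u) t =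
      (\<Sum>k\<in>Poly_Mapping.keys p. if k + u = t then Poly_Mapping.lookup p k else 0)"
    by (simp add: lookup_sum lookup_single when_def)
  show ?thesis
  proof (cases "u \<preceq> t")
    case True
    then have "k + u = t \<longleftrightarrow> k = t - u" for k
      using diff_add_exp by (metis add_diff_cancel_right')
    then show ?thesis using True by (simp add: * sum.delta in_keys_iff)
  next
    case False
    then have "k + u \<noteq> t" for k by auto
    then show ?thesis using False by (simp add: *)
  qed
qed

lemma lookup_mult_monomial_add [simp]:
  "Poly_Mapping.lookup (p * monomial u) (t + u) = Poly_Mapping.lookup (p :: _ \<Rightarrow>\<^sub>0 'k::field) t"
  by (simp add: lookup_mult_monomial)

lemma mult_monomial_eq_0_iff [simp]: "p * monomial u = 0 \<longleftrightarrow> p = (0 :: _ \<Rightarrow>\<^sub>0 'k::field)"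
proof
  assume 0: "p * monomial u = 0"
  show "p = 0"
  proof (rule poly_mapping_eqI)
    fix t
    show "Poly_Mapping.lookup p t = Poly_Mapping.lookup 0 t"
      using lookup_mult_monomial_add[of p u t] 0 by simp
  qed
qed simp

lemma single_mult_monomial:
  "Poly_Mapping.single t c * monomial u = Poly_Mapping.single (t + u) (c :: 'k::field)"
  by (simp add: monomial_def mult_single)

lemma monomial_mult: "monomial t * monomial u = (monomial (t + u) :: _ \<Rightarrow>\<^sub>0 'k::field)"
  by (simp add: monomial_def mult_single)

lemma monomial_0: "monomial 0 = 1"
  by (simp add: monomial_def)

lemma lookup_monomial: "Poly_Mapping.lookup (monomial t :: _ \<Rightarrow>\<^sub>0 'k::field) u = (if t = u then 1 else 0)"
  by (simp add: monomial_def lookup_single when_def)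

lemma monomial_neq_0 [simp]: "monomial t \<noteq> (0 :: _ \<Rightarrow>\<^sub>0 'k::field)"
  by (metis lookup_monomial lookup_zero one_neq_zero)

lemma mem_ideal_gen_monomial_iff:
  fixes p :: "('x \<Rightarrow>\<^sub>0 nat) \<Rightarrow>\<^sub>0 'k::field"
  shows "p \<in> ideal_gen (monomial ` G) \<longleftrightarrow> (\<forall>t\<in>Poly_Mapping.keys p. \<exists>g\<in>G. g \<preceq> t)"
proof
  interpret M: module "(*) :: (('x \<Rightarrow>\<^sub>0 nat) \<Rightarrow>\<^sub>0 'k) \<Rightarrow> _" by (rule module_mult)
  assume "p \<in> ideal_gen (monomial ` G)"
  then obtain v where "v \<in> free_on G" and p: "p = lin_ext (*) monomial v"
    unfolding lin_ext_image[OF module_mult, symmetric] by blast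
  show "\<forall>t\<in>Poly_Mapping.keys p. \<exists>g\<in>G. g \<preceq> t"
  proof
    fix t assume "t \<in> Poly_Mapping.keys p"
    then have "(\<Sum>g\<in>Poly_Mapping.keys v. Poly_Mapping.lookup (Poly_Mapping.lookup v g * monomial g) t) \<noteq> 0"
      by (simp add: p lin_ext_def in_keys_iff lookup_sum)
    then obtain g where "g \<in> Poly_Mapping.keys v" "Poly_Mapping.lookup (Poly_Mapping.lookup v g * monomial g) t \<noteq> 0"
      by (meson sum.neutral)
    then show "\<exists>g\<in>G. g \<preceq> t" using \<open>v \<in> free_on G\<close>
      by (auto simp: lookup_mult_monomial free_on_def split: if_splits)
  qed
next
  interpret M: module "(*) :: (('x \<Rightarrow>\<^sub>0 nat) \<Rightarrow>\<^sub>0 'k) \<Rightarrow> _" by (rule module_mult)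
  assume *: "\<forall>t\<in>Poly_Mapping.keys p. \<exists>g\<in>G. g \<preceq> t"
  have "p = (\<Sum>k\<in>Poly_Mapping.keys p. Poly_Mapping.single k (Poly_Mapping.lookup p k))"
    by (simp only: sum_single_lookup)
  also have "\<dots> \<in> ideal_gen (monomial ` G)"
  proof (rule M.span_sum)
    fix k assume "k \<in> Poly_Mapping.keys p"
    with * obtain g where g: "g \<in> G" "g \<preceq> k" by blast
    have "Poly_Mapping.single (k - g) (Poly_Mapping.lookup p k) * monomial g \<in> ideal_gen (monomial ` G)"
      using g(1) by (intro M.span_scale M.span_base) auto
    then show "Poly_Mapping.single k (Poly_Mapping.lookup p k) \<in> ideal_gen (monomial ` G)"
      using g(2) by (simp add: single_mult_monomial diff_add_exp)
  qed
  finally show "p \<in> ideal_gen (monomial ` G)" .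
qed

lemma monomial_mem_ideal_gen_iff:
  "(monomial t :: _ \<Rightarrow>\<^sub>0 'k::field) \<in> ideal_gen (monomial ` G) \<longleftrightarrow> (\<exists>g\<in>G. g \<preceq> t)"
  by (simp add: mem_ideal_gen_monomial_iff) (simp add: monomial_def)

lemma ideal_gen_monomial_cong:
  assumes "\<And>t. (\<exists>g\<in>G. g \<preceq> t) \<longleftrightarrow> (\<exists>g\<in>H. g \<preceq> t)"
  shows "ideal_gen (monomial ` G) = (ideal_gen (monomial ` H) :: (_ \<Rightarrow>\<^sub>0 'k::field) set)"
  by (rule set_eqI) (simp add: mem_ideal_gen_monomial_iff assms)

lemma ideal_gen_monomial_eqD:
  assumes "ideal_gen (monomial ` G) = (ideal_gen (monomial ` H) :: (_ \<Rightarrow>\<^sub>0 'k::field) set)" "g \<in> G"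
  shows "\<exists>h\<in>H. h \<preceq> g"
proof -
  have "(monomial g :: _ \<Rightarrow>\<^sub>0 'k) \<in> ideal_gen (monomial ` G)"
    unfolding monomial_mem_ideal_gen_iff using assms(2) by (intro bexI[of _ g]) auto
  then show ?thesis unfolding assms(1) monomial_mem_ideal_gen_iff .
qed

definition exp_antichain :: "('x \<Rightarrow>\<^sub>0 nat) set \<Rightarrow> bool" where
  "exp_antichain G \<longleftrightarrow> (\<forall>g\<in>G. \<forall>h\<in>G. g \<preceq> h \<longrightarrow> g = h)"

text \<open>A monomial lies in a monomial ideal iff a generator divides it, so a generator is
superfluous iff another one divides it.\<close>

lemma minimal_monomial_generators_iff:
  fixes I :: "(('x \<Rightarrow>\<^sub>0 nat) \<Rightarrow>\<^sub>0 'k::field) set"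
  shows "minimal_monomial_generators I G \<longleftrightarrow> ideal_gen (monomial ` G) = I \<and> exp_antichain G"
proof (intro iffI conjI)
  assume min: "minimal_monomial_generators I G"
  then show I: "ideal_gen (monomial ` G) = I" by (simp add: minimal_monomial_generators_def)
  show "exp_antichain G"
    unfolding exp_antichain_def
  proof (intro ballI impI, rule ccontr)
    fix g h assume gh: "g \<in> G" "h \<in> G" "g \<preceq> h" "g \<noteq> h"
    have "ideal_gen (monomial ` (G - {h})) = (ideal_gen (monomial ` G) :: (_ \<Rightarrow>\<^sub>0 'k) set)"
    proof (rule ideal_gen_monomial_cong)
      fix t show "(\<exists>g\<in>G - {h}. g \<preceq> t) \<longleftrightarrow> (\<exists>g\<in>G. g \<preceq> t)"
        using gh divides_exp_trans by (metis DiffE DiffI singletonD)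
    qed
    moreover have "G - {h} \<subset> G" using gh(2) by blast
    ultimately show False using min by (auto simp: minimal_monomial_generators_def)
  qed
next
  assume *: "ideal_gen (monomial ` G) = I \<and> exp_antichain G"
  have "ideal_gen (monomial ` H) \<noteq> I" if "H \<subset> G" for H
  proof
    assume eq: "ideal_gen (monomial ` H) = I"
    from that obtain g where g: "g \<in> G" "g \<notin> H" by blast
    have "\<exists>h\<in>H. h \<preceq> g"
      using ideal_gen_monomial_eqD[of G H g, where 'k='k] * eq g(1) by simp
    then show False using * g that by (auto simp: exp_antichain_def)
  qed
  with * show "minimal_monomial_generators I G" by (simp add: minimal_monomial_generators_def)
qed

text \<open>Each \<open>g \<in> G\<close> is divisible by some \<open>h \<in> H\<close>, which is divisible by some \<open>g' \<in> G\<close>; in an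
antichain this forces \<open>g' = g\<close>, hence \<open>h = g\<close>.\<close>

lemma minimal_monomial_generators_unique:
  fixes I :: "(('x \<Rightarrow>\<^sub>0 nat) \<Rightarrow>\<^sub>0 'k::field) set"
  assumes "minimal_monomial_generators I G" "minimal_monomial_generators I H"
  shows "G = H"
proof -
  have sub: "G \<subseteq> H" if "minimal_monomial_generators I G" "minimal_monomial_generators I H" for G H
  proof
    fix g assume g: "g \<in> G"
    have eq: "ideal_gen (monomial ` G) = (ideal_gen (monomial ` H) :: (_ \<Rightarrow>\<^sub>0 'k) set)"
      using that by (simp add: minimal_monomial_generators_iff)
    obtain h where h: "h \<in> H" "h \<preceq> g" using ideal_gen_monomial_eqD[OF eq g] by blast
    obtain g' where g': "g' \<in> G" "g' \<preceq> h" using ideal_gen_monomial_eqD[OF eq[symmetric] h(1)] by blast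
    have "g' = g" using that(1) g g'(1) divides_exp_trans[OF g'(2) h(2)]
      by (simp add: minimal_monomial_generators_iff exp_antichain_def)
    then have "h = g" using h(2) g'(2) divides_exp_antisym by blast
    with h(1) show "g \<in> H" by simp
  qed
  from sub[OF assms] sub[OF assms(2,1)] show ?thesis by blast
qed

section \<open>Exactness of the tree complex as connectivity\<close>

text \<open>The syzygy of \<open>m\<^sub>i\<close> and \<open>m\<^sub>j\<close>: the image of the basis vector of the edge \<open>(i, j)\<close> under \<open>d\<^sub>2\<close>.\<close>

definition syz :: "(nat \<Rightarrow> ('x \<Rightarrow>\<^sub>0 nat)) \<Rightarrow> nat \<times> nat \<Rightarrow> (nat \<Rightarrow>\<^sub>0 (('x \<Rightarrow>\<^sub>0 nat) \<Rightarrow>\<^sub>0 'k::field))" where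
  "syz m = (\<lambda>(i, j). Poly_Mapping.single i (monomial (lcm_exp (m i) (m j) - m i)) -
         Poly_Mapping.single j (monomial (lcm_exp (m i) (m j) - m j)))"

text \<open>The differential \<open>d\<^sub>1\<close> with all vertices outside \<open>C\<close> discarded. It kills the syzygy of an edge
unless the edge joins \<open>C\<close> to its complement, so it tells components apart.\<close>

definition partial_aug ::
  "(nat \<Rightarrow> ('x \<Rightarrow>\<^sub>0 nat)) \<Rightarrow> nat set \<Rightarrow> (nat \<Rightarrow>\<^sub>0 (('x \<Rightarrow>\<^sub>0 nat) \<Rightarrow>\<^sub>0 'k::field)) \<Rightarrow>
   (('x \<Rightarrow>\<^sub>0 nat) \<Rightarrow>\<^sub>0 'k)" where
  "partial_aug m C = lin_ext (*) (\<lambda>i. if i \<in> C then monomial (m i) else 0)"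

lemma tree_d1_eq: "tree_d1 m = lin_ext (*) (\<lambda>i. monomial (m i))"
  by (simp add: fun_eq_iff tree_d1_def lin_ext_def)

lemma tree_d1_eq_aug: "tree_d1 m = partial_aug m UNIV"
  by (simp add: tree_d1_eq partial_aug_def)

lemma tree_d2_eq: "tree_d2 m = lin_ext fscale (syz m)"
  by (simp add: fun_eq_iff tree_d2_def lin_ext_def syz_def case_prod_unfold)

lemma module_hom_tree_d1: "module_hom fscale (*) (tree_d1 m)"
  unfolding tree_d1_eq by (rule module_hom_lin_ext[OF module_mult])

lemma module_hom_tree_d2: "module_hom fscale fscale (tree_d2 m)"
  unfolding tree_d2_eq by (rule module_hom_lin_ext[OF module_fscale])

lemma tree_d2_single: "tree_d2 m (Poly_Mapping.single e a) = fscale a (syz m e)"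
  unfolding tree_d2_eq by (rule lin_ext_single[OF module_fscale])

lemma lookup_tree_d2:
  "Poly_Mapping.lookup (tree_d2 m w) i =
     (\<Sum>e\<in>Poly_Mapping.keys w. Poly_Mapping.lookup w e * Poly_Mapping.lookup (syz m e) i)"
  by (simp add: tree_d2_eq lin_ext_def lookup_sum lookup_fscale)

lemma lookup_syz:
  "Poly_Mapping.lookup (syz m (a, b)) i =
     (if i = a then monomial (lcm_exp (m a) (m b) - m a) else 0) -
     (if i = b then monomial (lcm_exp (m a) (m b) - m b) else 0)"
  by (auto simp: syz_def lookup_minus lookup_single when_def)

lemma syz_in_free_on: "a \<in> V \<Longrightarrow> b \<in> V \<Longrightarrow> syz m (a, b) \<in> free_on V"
  by (auto simp: free_on_def in_keys_iff lookup_syz split: if_splits)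

lemma module_hom_partial_aug: "module_hom fscale (*) (partial_aug m C)"
  unfolding partial_aug_def by (rule module_hom_lin_ext[OF module_mult])

lemma partial_aug_single:
  "m i \<preceq> l \<Longrightarrow> partial_aug m C (Poly_Mapping.single i (monomial (l - m i))) =
     (if i \<in> C then monomial l else 0)"
  by (simp add: partial_aug_def lin_ext_single[OF module_mult] monomial_mult diff_add_exp)

lemma partial_aug_syz:
  "partial_aug m C (syz m (a, b)) =
     ((if a \<in> C then 1 else 0) - (if b \<in> C then 1 else 0)) * monomial (lcm_exp (m a) (m b))"
  by (simp add: syz_def module_hom.diff[OF module_hom_partial_aug] partial_aug_single)

lemma partial_aug_tree_d2:
  "partial_aug m C (tree_d2 m w) =
     (\<Sum>e\<in>Poly_Mapping.keys w. Poly_Mapping.lookup w e * partial_aug m C (syz m e))"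
  by (simp add: tree_d2_eq lin_ext_def module_hom.sum[OF module_hom_partial_aug]
      module_hom.scale[OF module_hom_partial_aug])

lemma tree_d1_syz: "tree_d1 m (syz m e) = 0"
  by (cases e) (simp add: tree_d1_eq_aug partial_aug_syz)

lemma tree_d1_tree_d2: "tree_d1 m (tree_d2 m w) = 0"
  unfolding tree_d1_eq_aug partial_aug_tree_d2
  by (intro sum.neutral) (simp add: tree_d1_syz flip: tree_d1_eq_aug)

text \<open>Let \<open>C\<close> be the set of vertices that \<open>i\<close> reaches through labels dividing \<open>L\<close>, and suppose that
\<open>j\<close> is not among them. The augmentation restricted to \<open>C\<close> sends the syzygy of \<open>i\<close> and \<open>j\<close> to
the monomial with exponent \<open>L\<close>. On the image of \<open>d\<^sub>2\<close> the coefficient at \<open>L\<close> vanishes: an edge whose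
lcm divides \<open>L\<close> does not leave \<open>C\<close>, and any other edge only contributes multiples of an lcm that
does not divide \<open>L\<close>.\<close>

lemma connected_below_lcm:
  fixes m :: "nat \<Rightarrow> ('x \<Rightarrow>\<^sub>0 nat)"
  assumes span: "{v \<in> free_on V. tree_d1 m v = (0 :: ('x \<Rightarrow>\<^sub>0 nat) \<Rightarrow>\<^sub>0 'k::field)} \<subseteq>
      tree_d2 m ` free_on (oriented_edges E)"
    and ij: "i \<in> V" "j \<in> V" and L: "L = lcm_exp (m i) (m j)"
  shows "(i, j) \<in> {(a, b). {a, b} \<in> E \<and> m a \<preceq> L \<and> m b \<preceq> L}\<^sup>*"
proof (rule ccontr)
  define R where "R = {(a, b). {a, b} \<in> E \<and> m a \<preceq> L \<and> m b \<preceq> L}"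
  define C where "C = {a. (i, a) \<in> R\<^sup>*}"
  assume "(i, j) \<notin> {(a, b). {a, b} \<in> E \<and> m a \<preceq> L \<and> m b \<preceq> L}\<^sup>*"
  then have C: "i \<in> C" "j \<notin> C" by (auto simp: C_def R_def)
  have C_closed: "a \<in> C \<longleftrightarrow> b \<in> C" if "{a, b} \<in> E" "m a \<preceq> L" "m b \<preceq> L" for a b
  proof -
    have "(a, b) \<in> R" "(b, a) \<in> R" using that by (auto simp: R_def insert_commute)
    then show ?thesis unfolding C_def by (auto intro: rtrancl_into_rtrancl)
  qed
  let ?v = "syz m (i, j) :: nat \<Rightarrow>\<^sub>0 (('x \<Rightarrow>\<^sub>0 nat) \<Rightarrow>\<^sub>0 'k)"
  have "?v \<in> {v \<in> free_on V. tree_d1 m v = 0}"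
    using ij by (simp add: syz_in_free_on tree_d1_syz)
  then have "?v \<in> tree_d2 m ` free_on (oriented_edges E)" using span by blast
  then obtain w where w: "w \<in> free_on (oriented_edges E)" "?v = tree_d2 m w" by blast
  have "Poly_Mapping.lookup (Poly_Mapping.lookup w e * partial_aug m C (syz m e)) L = 0"
    if "e \<in> Poly_Mapping.keys w" for e
  proof (rule ccontr)
    obtain a b where e: "e = (a, b)" by fastforce
    assume *: "Poly_Mapping.lookup (Poly_Mapping.lookup w e * partial_aug m C (syz m e)) L \<noteq> 0"
    have "(a, b) \<in> oriented_edges E" using that w(1) by (auto simp: free_on_def e)
    then have "{a, b} \<in> E" by (simp add: oriented_edges_def)
    moreover have "(a \<in> C) \<noteq> (b \<in> C)" "lcm_exp (m a) (m b) \<preceq> L"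
      using * by (auto simp: e partial_aug_syz lookup_mult_monomial split: if_splits)
    ultimately show False using C_closed[of a b] by (auto simp: divides_exp_lcm_iff)
  qed
  then have "Poly_Mapping.lookup (partial_aug m C ?v) L = 0"
    unfolding w(2) partial_aug_tree_d2 lookup_sum by simp
  then show False using C by (simp add: partial_aug_syz L lookup_monomial)
qed

text \<open>Scaled up to a common multiple \<open>L\<close> of the labels, the edge syzygies become differences of one
fixed vector per vertex, and these telescope along a path.\<close>

lemma path_difference_in_image:
  fixes m :: "nat \<Rightarrow> ('x \<Rightarrow>\<^sub>0 nat)"
  assumes F: "\<And>e. e \<in> F \<Longrightarrow> card e = 2 \<and> (\<forall>i\<in>e. m i \<preceq> L)"
    and path: "(x, y) \<in> {(a, b). {a, b} \<in> F}\<^sup>*"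
  shows "\<exists>w \<in> free_on (oriented_edges F). tree_d2 m w =
     Poly_Mapping.single x (monomial (L - m x)) -
     (Poly_Mapping.single y (monomial (L - m y)) :: nat \<Rightarrow>\<^sub>0 (('x \<Rightarrow>\<^sub>0 nat) \<Rightarrow>\<^sub>0 'k::field))"
  using path
proof (induction rule: rtrancl_induct)
  case base
  interpret H: module_hom fscale fscale "tree_d2 m :: _ \<Rightarrow> nat \<Rightarrow>\<^sub>0 (('x \<Rightarrow>\<^sub>0 nat) \<Rightarrow>\<^sub>0 'k)"
    by (rule module_hom_tree_d2)
  show ?case by (intro bexI[of _ 0]) (simp_all add: H.zero free_on_def)
next
  case (step a b)
  interpret H: module_hom fscale fscale "tree_d2 m :: _ \<Rightarrow> nat \<Rightarrow>\<^sub>0 (('x \<Rightarrow>\<^sub>0 nat) \<Rightarrow>\<^sub>0 'k)"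
    by (rule module_hom_tree_d2)
  let ?S = "\<lambda>i. Poly_Mapping.single i (monomial (L - m i)) :: nat \<Rightarrow>\<^sub>0 (('x \<Rightarrow>\<^sub>0 nat) \<Rightarrow>\<^sub>0 'k)"
  have edge: "\<exists>w \<in> free_on (oriented_edges F). tree_d2 m w = ?S a - ?S b"
    if "{a, b} \<in> F" "a < b" for a b
  proof
    let ?l = "lcm_exp (m a) (m b)"
    let ?w = "Poly_Mapping.single (a, b) (monomial (L - ?l)) :: nat \<times> nat \<Rightarrow>\<^sub>0 (('x \<Rightarrow>\<^sub>0 nat) \<Rightarrow>\<^sub>0 'k)"
    show "?w \<in> free_on (oriented_edges F)" using that by (auto simp: free_on_def oriented_edges_def)
    have lL: "?l \<preceq> L" using F[OF that(1)] by (simp add: divides_exp_lcm_iff)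
    have "L - ?l + (?l - m i) = L - m i" if "m i \<preceq> ?l" for i
    proof -
      have "L - ?l + (?l - m i) + m i = L - m i + m i"
        using lL that divides_exp_trans[OF that lL] by (simp add: add.assoc diff_add_exp)
      then show ?thesis by simp
    qed
    then have "fscale (monomial (L - ?l)) (syz m (a, b)) = ?S a - ?S b"
      by (intro poly_mapping_eqI)
         (auto simp: lookup_fscale lookup_syz lookup_minus lookup_single when_def monomial_mult right_diff_distrib)
    then show "tree_d2 m ?w = ?S a - ?S b" by (simp add: tree_d2_single)
  qed
  have "{a, b} \<in> F" using step.hyps by simp
  have "a \<noteq> b" using F[OF \<open>{a, b} \<in> F\<close>] by auto
  have "\<exists>w \<in> free_on (oriented_edges F). tree_d2 m w = ?S a - ?S b"
  proof (cases "a < b")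
    case False
    then obtain w where "w \<in> free_on (oriented_edges F)" "tree_d2 m w = ?S b - ?S a"
      using edge[of b a] \<open>{a, b} \<in> F\<close> \<open>a \<noteq> b\<close> by (auto simp: insert_commute)
    then show ?thesis
      using module.subspace_neg[OF module_fscale subspace_free_on] by (intro bexI[of _ "- w"]) (auto simp: H.neg)
  qed (use edge \<open>{a, b} \<in> F\<close> in blast)
  then obtain w where w: "w \<in> free_on (oriented_edges F)" "tree_d2 m w = ?S a - ?S b" by blast
  obtain w' where w': "w' \<in> free_on (oriented_edges F)" "tree_d2 m w' = ?S x - ?S a" using step.IH by blast
  show ?case
    using module.subspace_add[OF module_fscale subspace_free_on w'(1) w(1)] w w'
    by (intro bexI[of _ "w' + w"]) (auto simp: H.add)
qed

text \<open>Otherwise the edge itself and the detour around it give two different preimages of the same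
element.\<close>

lemma bridge_if_inj:
  fixes m :: "nat \<Rightarrow> ('x \<Rightarrow>\<^sub>0 nat)"
  assumes inj: "inj_on (tree_d2 m :: (nat \<times> nat \<Rightarrow>\<^sub>0 (('x \<Rightarrow>\<^sub>0 nat) \<Rightarrow>\<^sub>0 'k::field)) \<Rightarrow> _)
      (free_on (oriented_edges E))"
    and E: "finite V" "\<And>e. e \<in> E \<Longrightarrow> e \<subseteq> V \<and> card e = 2" and xy: "{x, y} \<in> E"
  shows "(x, y) \<notin> {(a, b). {a, b} \<in> E - {{x, y}}}\<^sup>*"
proof
  assume path: "(x, y) \<in> {(a, b). {a, b} \<in> E - {{x, y}}}\<^sup>*"
  \<comment> \<open>Any common multiple of the labels would do.\<close>
  define L where "L = (\<Sum>i\<in>V. m i)"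
  have L: "\<forall>i\<in>e. m i \<preceq> L" if "e \<in> E" for e
    using E(2)[OF that] divides_exp_sum[OF E(1), of _ m] by (auto simp: L_def)
  obtain w where w: "w \<in> free_on (oriented_edges (E - {{x, y}}))" "tree_d2 m w =
     Poly_Mapping.single x (monomial (L - m x)) -
     (Poly_Mapping.single y (monomial (L - m y)) :: nat \<Rightarrow>\<^sub>0 (('x \<Rightarrow>\<^sub>0 nat) \<Rightarrow>\<^sub>0 'k))"
    using path_difference_in_image[of "E - {{x, y}}" m L x y, where 'k='k] path E(2) L by blast
  obtain w' where w': "w' \<in> free_on (oriented_edges {{x, y}})" "tree_d2 m w' =
     Poly_Mapping.single x (monomial (L - m x)) -
     (Poly_Mapping.single y (monomial (L - m y)) :: nat \<Rightarrow>\<^sub>0 (('x \<Rightarrow>\<^sub>0 nat) \<Rightarrow>\<^sub>0 'k))"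
    using path_difference_in_image[of "{{x, y}}" m L x y, where 'k='k] xy E(2) L by blast
  have "w \<in> free_on (oriented_edges E)" "w' \<in> free_on (oriented_edges E)"
    using w(1) w'(1) xy by (auto simp: free_on_def oriented_edges_def)
  then have "w = w'" using inj w(2) w'(2) by (metis inj_onD)
  then have "Poly_Mapping.keys w = {}"
    using w(1) w'(1) by (fastforce simp: free_on_def oriented_edges_def)
  then have "w = 0" by simp
  interpret H: module_hom fscale fscale "tree_d2 m :: _ \<Rightarrow> nat \<Rightarrow>\<^sub>0 (('x \<Rightarrow>\<^sub>0 nat) \<Rightarrow>\<^sub>0 'k)"
    by (rule module_hom_tree_d2)
  have "x \<noteq> y" using E(2)[OF xy] by auto
  have "Poly_Mapping.lookup (tree_d2 m w) x = (0 :: ('x \<Rightarrow>\<^sub>0 nat) \<Rightarrow>\<^sub>0 'k)"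
    using \<open>w = 0\<close> by (simp add: H.zero)
  then show False unfolding w(2) using \<open>x \<noteq> y\<close> by (simp add: lookup_minus lookup_single)
qed

text \<open>A cycle would be a detour around its first edge.\<close>

lemma is_tree_if_resolution:
  fixes m :: "nat \<Rightarrow> ('x \<Rightarrow>\<^sub>0 nat)"
  assumes inj: "inj_on (tree_d2 m :: (nat \<times> nat \<Rightarrow>\<^sub>0 (('x \<Rightarrow>\<^sub>0 nat) \<Rightarrow>\<^sub>0 'k::field)) \<Rightarrow> _)
      (free_on (oriented_edges E))"
    and span: "{v \<in> free_on V. tree_d1 m v = (0 :: ('x \<Rightarrow>\<^sub>0 nat) \<Rightarrow>\<^sub>0 'k)} \<subseteq>
      tree_d2 m ` free_on (oriented_edges E)"
    and E: "finite V" "V \<noteq> {}" "\<And>e. e \<in> E \<Longrightarrow> e \<subseteq> V \<and> card e = 2"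
  shows "is_tree V E"
  unfolding is_tree_def
proof (intro conjI ballI)
  fix u v assume "u \<in> V" "v \<in> V"
  then have "(u, v) \<in> {(a, b). {a, b} \<in> E \<and> m a \<preceq> lcm_exp (m u) (m v) \<and> m b \<preceq> lcm_exp (m u) (m v)}\<^sup>*"
    using connected_below_lcm[OF span, of u v] by blast
  then show "(u, v) \<in> {(a, b). {a, b} \<in> E}\<^sup>*"
    by (rule rev_subsetD[OF _ rtrancl_mono]) blast
next
  show "\<not> (\<exists>c. length c \<ge> 3 \<and> distinct c \<and> (\<forall>i<length c. {c ! i, c ! (Suc i mod length c)} \<in> E))"
  proof
    assume "\<exists>c. length c \<ge> 3 \<and> distinct c \<and> (\<forall>i<length c. {c ! i, c ! (Suc i mod length c)} \<in> E)"
    then obtain c where c: "length c \<ge> 3" "distinct c"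
      "\<And>i. i < length c \<Longrightarrow> {c ! i, c ! (Suc i mod length c)} \<in> E" by blast
    let ?R = "{(a, b). {a, b} \<in> E - {{c ! 0, c ! 1}}}"
    have len: "0 < length c" "1 < length c" using c(1) by linarith+
    \<comment> \<open>Walk along the cycle from its second vertex back to the first one, without its first edge.\<close>
    have "(c ! 1, c ! (Suc k mod length c)) \<in> ?R\<^sup>*" if "k < length c" for k
      using that
    proof (induction k)
      case 0
      then show ?case using c(1) by simp
    next
      case (Suc k)
      let ?n = "Suc (Suc k) mod length c"
      have n: "?n < length c" using len(1) by (intro mod_less_divisor)
      have *: "c ! Suc k \<noteq> c ! 0"
        using nth_eq_iff_index_eq[OF c(2) Suc.prems len(1)] by simp
      have "{c ! Suc k, c ! ?n} \<noteq> {c ! 0, c ! 1}"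
      proof
        assume "{c ! Suc k, c ! ?n} = {c ! 0, c ! 1}"
        with * have "c ! Suc k = c ! 1" "c ! ?n = c ! 0" by (auto simp: doubleton_eq_iff)
        then have "Suc k = 1" "?n = 0"
          using nth_eq_iff_index_eq[OF c(2) Suc.prems len(2)] nth_eq_iff_index_eq[OF c(2) n len(1)]
          by simp_all
        then show False using c(1) by simp
      qed
      then have "(c ! Suc k, c ! ?n) \<in> ?R" using c(3)[OF Suc.prems] by simp
      moreover have "(c ! 1, c ! Suc k) \<in> ?R\<^sup>*" using Suc by simp
      ultimately show ?case by (rule rtrancl_into_rtrancl[rotated])
    qed
    moreover have "Suc (length c - 1) mod length c = 0" "length c - 1 < length c" using len by simp_all
    ultimately have "(c ! 1, c ! 0) \<in> ?R\<^sup>*" by metis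
    moreover have "{c ! 1, c ! 0} \<in> E" using len c(3)[of 0] by (simp add: insert_commute)
    ultimately show False
      using bridge_if_inj[OF inj E(1,3), of "c ! 1" "c ! 0"] by (simp add: insert_commute)
  qed
qed (use E in auto)

section \<open>Exactness from elimination\<close>

lemma tree_d2_in_free_on:
  assumes "w \<in> free_on D" "\<And>a b. (a, b) \<in> D \<Longrightarrow> a \<in> V \<and> b \<in> V"
  shows "tree_d2 m w \<in> free_on V"
  unfolding tree_d2_eq
proof (rule lin_ext_mem[OF module_fscale subspace_free_on assms(1)])
  show "syz m e \<in> free_on V" if "e \<in> D" for e
    using that assms(2) by (cases e) (auto intro: syz_in_free_on)
qed

text \<open>The monomial \<open>t + m\<^sub>i\<close> has to cancel in \<open>\<Sum>\<^sub>h v\<^sub>h m\<^sub>h = 0\<close>, so it occurs in a second summand.\<close>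

lemma exists_smaller_divisor:
  fixes v :: "nat \<Rightarrow>\<^sub>0 (('x \<Rightarrow>\<^sub>0 nat) \<Rightarrow>\<^sub>0 'k::field)"
  assumes "tree_d1 m v = 0" "t \<in> Poly_Mapping.keys (Poly_Mapping.lookup v i)"
  shows "\<exists>h\<in>Poly_Mapping.keys v - {i}. m h \<preceq> t + m i"
proof (rule ccontr)
  assume *: "\<not> ?thesis"
  have i: "i \<in> Poly_Mapping.keys v" using assms(2) by (auto simp: in_keys_iff)
  have "Poly_Mapping.lookup (tree_d1 m v) (t + m i) = (\<Sum>h\<in>Poly_Mapping.keys v.
      Poly_Mapping.lookup (Poly_Mapping.lookup v h * monomial (m h)) (t + m i))"
    by (simp add: tree_d1_def lookup_sum)
  also have "\<dots> = Poly_Mapping.lookup (Poly_Mapping.lookup v i * monomial (m i)) (t + m i)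
      + (\<Sum>h\<in>Poly_Mapping.keys v - {i}.
      Poly_Mapping.lookup (Poly_Mapping.lookup v h * monomial (m h)) (t + m i))"
    using i by (intro sum.remove) auto
  also have "\<dots> = Poly_Mapping.lookup (Poly_Mapping.lookup v i) t"
    using * by (simp add: lookup_mult_monomial)
  finally show False using assms by (simp add: in_keys_iff)
qed

text \<open>Induction on the last coordinate of the syzygy: each of its terms \<open>t\<close> satisfies
\<open>lcm m\<^sub>i m\<^sub>h | t m\<^sub>i\<close> for some \<open>h < i\<close>, so a multiple of the syzygy of \<open>p\<close> and \<open>i\<close> removes it
without touching coordinates beyond \<open>i\<close>. With all pairs for \<open>D\<close> and \<open>p = h\<close> this says that pairwise
syzygies generate all syzygies; with one pair for each \<open>i\<close> it gives the exactness of a tree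
complex.\<close>

lemma kernel_in_image_if_elimination:
  fixes m :: "nat \<Rightarrow> ('x \<Rightarrow>\<^sub>0 nat)"
  assumes elim: "\<And>h i. 1 \<le> h \<Longrightarrow> h < i \<Longrightarrow> i \<le> r \<Longrightarrow>
      \<exists>p. (p, i) \<in> D \<and> 1 \<le> p \<and> p < i \<and> m p \<preceq> lcm_exp (m i) (m h)"
  shows "{v \<in> free_on {1..r}. tree_d1 m v = (0 :: ('x \<Rightarrow>\<^sub>0 nat) \<Rightarrow>\<^sub>0 'k::field)} \<subseteq> tree_d2 m ` free_on D"
proof -
  interpret F: module "fscale :: (('x \<Rightarrow>\<^sub>0 nat) \<Rightarrow>\<^sub>0 'k) \<Rightarrow> (nat \<Rightarrow>\<^sub>0 _) \<Rightarrow> _" by (rule module_fscale)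
  interpret F2: module "fscale :: (('x \<Rightarrow>\<^sub>0 nat) \<Rightarrow>\<^sub>0 'k) \<Rightarrow> (nat \<times> nat \<Rightarrow>\<^sub>0 _) \<Rightarrow> _" by (rule module_fscale)
  interpret d1: module_hom fscale "(*)" "tree_d1 m :: _ \<Rightarrow> ('x \<Rightarrow>\<^sub>0 nat) \<Rightarrow>\<^sub>0 'k"
    by (rule module_hom_tree_d1)
  interpret d2: module_hom fscale fscale "tree_d2 m :: _ \<Rightarrow> nat \<Rightarrow>\<^sub>0 (('x \<Rightarrow>\<^sub>0 nat) \<Rightarrow>\<^sub>0 'k)"
    by (rule module_hom_tree_d2)
  have "v \<in> tree_d2 m ` free_on D"
    if "n \<le> r" "v \<in> free_on {1..n}" "tree_d1 m v = 0"
    for n and v :: "nat \<Rightarrow>\<^sub>0 (('x \<Rightarrow>\<^sub>0 nat) \<Rightarrow>\<^sub>0 'k)"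
    using that
  proof (induction n arbitrary: v)
    case 0
    then have "v = 0" by (simp add: free_on_def)
    then have "v = tree_d2 m 0" by (simp add: d2.zero)
    then show ?case using F2.subspace_0[OF subspace_free_on] by (rule image_eqI)
  next
    case (Suc n)
    define i where "i = Suc n"
    let ?vi = "Poly_Mapping.lookup v i"
    have "\<exists>p. (p, i) \<in> D \<and> 1 \<le> p \<and> p < i \<and> lcm_exp (m p) (m i) \<preceq> t + m i"
      if "t \<in> Poly_Mapping.keys ?vi" for t
    proof -
      obtain h where h: "h \<in> Poly_Mapping.keys v - {i}" "m h \<preceq> t + m i"
        using exists_smaller_divisor[OF Suc.prems(3) \<open>t \<in> Poly_Mapping.keys ?vi\<close>] by blast
      have "h \<in> {1..i}" "h \<noteq> i" using h(1) Suc.prems(2) unfolding free_on_def i_def by blast+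
      then have "1 \<le> h" "h < i" by simp_all
      then obtain p where p: "(p, i) \<in> D" "1 \<le> p" "p < i" "m p \<preceq> lcm_exp (m i) (m h)"
        using elim[of h i] Suc.prems(1) by (auto simp: i_def)
      have "lcm_exp (m i) (m h) \<preceq> t + m i" using h(2) by (simp add: divides_exp_lcm_iff)
      then have "lcm_exp (m p) (m i) \<preceq> t + m i"
        using divides_exp_trans[OF p(4)] by (simp add: divides_exp_lcm_iff)
      with p show ?thesis by blast
    qed
    then obtain p where p: "\<And>t. t \<in> Poly_Mapping.keys ?vi \<Longrightarrow>
        (p t, i) \<in> D \<and> 1 \<le> p t \<and> p t < i \<and> lcm_exp (m (p t)) (m i) \<preceq> t + m i" by metis
    \<comment> \<open>The sign occurs because \<open>i\<close> is the second vertex of each pair \<open>(p t, i)\<close>.\<close>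
    define w where "w = - (\<Sum>t\<in>Poly_Mapping.keys ?vi. Poly_Mapping.single (p t, i)
      (Poly_Mapping.single (t + m i - lcm_exp (m (p t)) (m i)) (Poly_Mapping.lookup ?vi t)))"
    have wD: "w \<in> free_on (D \<inter> {1..<i} \<times> {i})"
      unfolding w_def using p by (intro F2.subspace_neg F2.subspace_sum subspace_free_on) (auto simp: free_on_def)
    have w: "w \<in> free_on D" using wD by (auto simp: free_on_def)
    have "tree_d2 m w \<in> free_on {1..i}" by (rule tree_d2_in_free_on[OF wD]) auto
    then have u1: "v - tree_d2 m w \<in> free_on {1..i}"
      using Suc.prems(2) by (intro F.subspace_diff[OF subspace_free_on]) (simp_all add: i_def)
    have "Poly_Mapping.lookup (tree_d2 m w) i = ?vi"
    proof -
      have "Poly_Mapping.lookup (tree_d2 m w) i = - (\<Sum>t\<in>Poly_Mapping.keys ?vi.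
          Poly_Mapping.single (t + m i - lcm_exp (m (p t)) (m i)) (Poly_Mapping.lookup ?vi t) *
          Poly_Mapping.lookup (syz m (p t, i)) i)"
        by (simp add: w_def d2.neg d2.sum lookup_sum tree_d2_single lookup_fscale)
      also have "\<dots> = (\<Sum>t\<in>Poly_Mapping.keys ?vi. Poly_Mapping.single t (Poly_Mapping.lookup ?vi t))"
        unfolding sum_negf[symmetric]
      proof (intro sum.cong refl)
        fix t assume t: "t \<in> Poly_Mapping.keys ?vi"
        let ?l = "lcm_exp (m (p t)) (m i)"
        have "t + m i - ?l + (?l - m i) + m i = t + m i"
          using p[OF t] by (simp add: add.assoc diff_add_exp)
        then have "t + m i - ?l + (?l - m i) = t" by simp
        then show "- (Poly_Mapping.single (t + m i - ?l) (Poly_Mapping.lookup ?vi t) *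
            Poly_Mapping.lookup (syz m (p t, i)) i) = Poly_Mapping.single t (Poly_Mapping.lookup ?vi t)"
          using p[OF t] by (simp add: lookup_syz single_mult_monomial)
      qed
      also have "\<dots> = ?vi" by (rule sum_single_lookup)
      finally show ?thesis .
    qed
    then have "i \<notin> Poly_Mapping.keys (v - tree_d2 m w)" by (simp add: in_keys_iff lookup_minus)
    with u1 have "v - tree_d2 m w \<in> free_on {1..n}"
      by (auto simp: free_on_def i_def subset_iff le_Suc_eq)
    moreover have "tree_d1 m (v - tree_d2 m w) = 0"
      using Suc.prems(3) by (simp add: d1.diff tree_d1_tree_d2)
    ultimately obtain w' where "w' \<in> free_on D" "v - tree_d2 m w = tree_d2 m w'"
      using Suc.IH[of "v - tree_d2 m w"] Suc.prems(1) by auto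
    then show ?case using w F2.subspace_add[OF subspace_free_on w]
      by (intro image_eqI[of _ _ "w + w'"]) (auto simp: d2.add algebra_simps)
  qed
  then show ?thesis by blast
qed

lemma inj_on_tree_d2_iff:
  "inj_on (tree_d2 m :: (nat \<times> nat \<Rightarrow>\<^sub>0 (('x \<Rightarrow>\<^sub>0 nat) \<Rightarrow>\<^sub>0 'k::field)) \<Rightarrow> _) (free_on D) \<longleftrightarrow>
     (\<forall>w\<in>free_on D. tree_d2 m w = (0 :: _ \<Rightarrow>\<^sub>0 (('x \<Rightarrow>\<^sub>0 nat) \<Rightarrow>\<^sub>0 'k)) \<longrightarrow> w = 0)"
  by (rule module_hom.inj_on_iff_eq_0[OF module_hom_tree_d2 subspace_free_on])

text \<open>The matrix is triangular: among the pairs in the support of \<open>w\<close> only one contains the largest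
occurring vertex.\<close>

lemma inj_tree_d2_if_single_parent:
  fixes m :: "nat \<Rightarrow> ('x \<Rightarrow>\<^sub>0 nat)"
  assumes less: "\<And>a i. (a, i) \<in> D \<Longrightarrow> a < i"
    and unique: "\<And>a b i. (a, i) \<in> D \<Longrightarrow> (b, i) \<in> D \<Longrightarrow> a = b"
  shows "inj_on (tree_d2 m :: (nat \<times> nat \<Rightarrow>\<^sub>0 (('x \<Rightarrow>\<^sub>0 nat) \<Rightarrow>\<^sub>0 'k::field)) \<Rightarrow> _) (free_on D)"
  unfolding inj_on_tree_d2_iff
proof (intro ballI impI, rule ccontr)
  fix w :: "nat \<times> nat \<Rightarrow>\<^sub>0 (('x \<Rightarrow>\<^sub>0 nat) \<Rightarrow>\<^sub>0 'k)"
  assume w: "w \<in> free_on D" "tree_d2 m w = 0" "w \<noteq> 0"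
  define i where "i = Max (snd ` Poly_Mapping.keys w)"
  have "Poly_Mapping.keys w \<noteq> {}" using w(3) by simp
  then have "i \<in> snd ` Poly_Mapping.keys w" unfolding i_def by (intro Max_in) auto
  then obtain a where a: "(a, i) \<in> Poly_Mapping.keys w" by force
  have le: "c \<le> i" if "(b, c) \<in> Poly_Mapping.keys w" for b c
    unfolding i_def using that by (intro Max_ge) force+
  have D: "e \<in> D" if "e \<in> Poly_Mapping.keys w" for e using w(1) that by (auto simp: free_on_def)
  have "Poly_Mapping.lookup w e * Poly_Mapping.lookup (syz m e) i = 0"
    if "e \<in> Poly_Mapping.keys w - {(a, i)}" for e
  proof -
    obtain b c where e: "e = (b, c)" by fastforce
    have "b < c" "c \<le> i" "c \<noteq> i" using that less[of b c] le[of b c] unique[of b i a] D a by (auto simp: e)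
    then show ?thesis by (simp add: e lookup_syz)
  qed
  then have "Poly_Mapping.lookup (tree_d2 m w) i =
      Poly_Mapping.lookup w (a, i) * Poly_Mapping.lookup (syz m (a, i)) i"
    unfolding lookup_tree_d2 using a by (subst sum.remove[of _ "(a, i)"]) auto
  also have "\<dots> \<noteq> 0"
    using a less[OF D[OF a]] by (simp add: lookup_syz in_keys_iff)
  finally show False using w(2) by simp
qed

lemma monomial_in_max_ideal:
  assumes "t \<noteq> 0"
  shows "(monomial t :: _ \<Rightarrow>\<^sub>0 'k::field) \<in> max_ideal"
proof -
  obtain x where "Poly_Mapping.lookup t x \<noteq> 0"
    using assms by (metis lookup_zero poly_mapping_eqI)
  then have "Poly_Mapping.single x 1 \<preceq> t"
    by (auto simp: divides_exp_def lookup_single when_def)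
  then have "monomial t = monomial (t - Poly_Mapping.single x 1) * (var x :: _ \<Rightarrow>\<^sub>0 'k)"
    by (simp add: var_def monomial_mult diff_add_exp)
  also have "\<dots> \<in> max_ideal" unfolding max_ideal_def
    by (intro module.span_scale[OF module_mult] module.span_base[OF module_mult]) blast
  finally show ?thesis .
qed

text \<open>The entries of the matrices are the labels \<open>m\<^sub>i\<close> and the quotients \<open>lcm m\<^sub>i m\<^sub>j / m\<^sub>i\<close>, and such
a quotient is \<open>1\<close> only if \<open>m\<^sub>j\<close> divides \<open>m\<^sub>i\<close>.\<close>

lemma tree_minimal_if_antichain:
  fixes m :: "nat \<Rightarrow> ('x \<Rightarrow>\<^sub>0 nat)"
  assumes "exp_antichain (m ` V)" "inj_on m V" "0 \<notin> m ` V"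
    and E: "\<And>e. e \<in> E \<Longrightarrow> e \<subseteq> V \<and> card e = 2"
  shows "tree_minimal TYPE('k::field) V E m"
  unfolding tree_minimal_def
proof (intro conjI image_subsetI)
  fix v :: "nat \<Rightarrow>\<^sub>0 (('x \<Rightarrow>\<^sub>0 nat) \<Rightarrow>\<^sub>0 'k)" assume v: "v \<in> free_on V"
  show "tree_d1 m v \<in> ideal_times (*) max_ideal UNIV"
    unfolding tree_d1_eq ideal_times_def
  proof (rule lin_ext_mem[OF module_mult module.subspace_span[OF module_mult] v])
    fix i assume "i \<in> V"
    then have "m i \<noteq> 0" using assms(3) by (metis imageI)
    then have "monomial (m i) * 1 \<in> {a * v |a v. a \<in> (max_ideal :: (('x \<Rightarrow>\<^sub>0 nat) \<Rightarrow>\<^sub>0 'k) set) \<and> v \<in> UNIV}"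
      using monomial_in_max_ideal by blast
    then show "monomial (m i) \<in> ideal_gen {a * v |a v. a \<in> (max_ideal :: (('x \<Rightarrow>\<^sub>0 nat) \<Rightarrow>\<^sub>0 'k) set) \<and> v \<in> UNIV}"
      by (intro module.span_base[OF module_mult]) simp
  qed
next
  fix w :: "nat \<times> nat \<Rightarrow>\<^sub>0 (('x \<Rightarrow>\<^sub>0 nat) \<Rightarrow>\<^sub>0 'k)" assume w: "w \<in> free_on (oriented_edges E)"
  show "tree_d2 m w \<in> ideal_times fscale max_ideal (free_on V)"
    unfolding tree_d2_eq ideal_times_def
  proof (rule lin_ext_mem[OF module_fscale module.subspace_span[OF module_fscale] w])
    let ?X = "{fscale a v |a v. a \<in> (max_ideal :: (('x \<Rightarrow>\<^sub>0 nat) \<Rightarrow>\<^sub>0 'k) set) \<and> v \<in> free_on V}"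
    fix e assume "e \<in> oriented_edges E"
    then obtain a b where e: "e = (a, b)" "a < b" "{a, b} \<in> E" by (auto simp: oriented_edges_def)
    then have ab: "a \<in> V" "b \<in> V" using E[OF e(3)] by auto
    have *: "Poly_Mapping.single i (monomial (lcm_exp (m a) (m b) - m i)) \<in> module.span fscale ?X"
      if i: "i \<in> {a, b}" for i
    proof -
      have "lcm_exp (m a) (m b) - m i \<noteq> 0"
      proof
        assume "lcm_exp (m a) (m b) - m i = 0"
        then have "lcm_exp (m a) (m b) = m i"
          using diff_add_exp[of "m i" "lcm_exp (m a) (m b)"] i by auto
        then have "m a \<preceq> m i" "m b \<preceq> m i" using divides_exp_lcm by metis+
        then have "m a = m i" "m b = m i"
          using assms(1) i ab unfolding exp_antichain_def by blast+
        then have "m a = m b" by simp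
        then show False using assms(2) ab e(2) by (auto dest: inj_onD)
      qed
      moreover have "basis_vec i \<in> free_on V" using i ab by (auto simp: free_on_def)
      ultimately have "fscale (monomial (lcm_exp (m a) (m b) - m i)) (basis_vec i) \<in> ?X"
        using monomial_in_max_ideal by blast
      moreover have "fscale (monomial (lcm_exp (m a) (m b) - m i)) (basis_vec i) =
          (Poly_Mapping.single i (monomial (lcm_exp (m a) (m b) - m i)) :: nat \<Rightarrow>\<^sub>0 (('x \<Rightarrow>\<^sub>0 nat) \<Rightarrow>\<^sub>0 'k))"
        by (rule poly_mapping_eqI) (simp add: lookup_fscale lookup_single when_def)
      ultimately show ?thesis by (intro module.span_base[OF module_fscale]) simp
    qed
    show "syz m e \<in> module.span fscale ?X"
      unfolding e(1) syz_def using * by (simp add: module.span_diff[OF module_fscale])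
  qed
qed

lemma oriented_edges_unorient:
  assumes "\<And>i j. (i, j) \<in> D \<Longrightarrow> i < j"
  shows "oriented_edges ((\<lambda>(i, j). {i, j}) ` D) = D"
  using assms by (fastforce simp: oriented_edges_def doubleton_eq_iff)

lemma tree_d1_image: "tree_d1 m ` free_on V = ideal_gen (monomial ` m ` V)"
  unfolding tree_d1_eq lin_ext_image[OF module_mult] image_image ..

text \<open>Once the labels are the minimal generators, the exactness of the complex implies both that the
pairs form a tree and that the resolution is minimal. Both constructions of a tree end here.\<close>

lemma minimal_resolution_if_exact:
  fixes I :: "(('x \<Rightarrow>\<^sub>0 nat) \<Rightarrow>\<^sub>0 'k::field) set"
  assumes I: "I \<noteq> {0}" "I \<noteq> UNIV"
    and gens: "inj_on m {1..r}" "minimal_monomial_generators I (m ` {1..r})"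
    and D: "D \<subseteq> {(i, j). 1 \<le> i \<and> i < j \<and> j \<le> r}"
    and inj: "inj_on (tree_d2 m :: (nat \<times> nat \<Rightarrow>\<^sub>0 (('x \<Rightarrow>\<^sub>0 nat) \<Rightarrow>\<^sub>0 'k)) \<Rightarrow> _) (free_on D)"
    and span: "{v \<in> free_on {1..r}. tree_d1 m v = (0 :: ('x \<Rightarrow>\<^sub>0 nat) \<Rightarrow>\<^sub>0 'k)} \<subseteq> tree_d2 m ` free_on D"
  shows "minimal_resolution_supported_on_tree I"
proof -
  define E where "E = (\<lambda>(i, j). {i, j}) ` D"
  have DE: "oriented_edges E = D" unfolding E_def using D by (intro oriented_edges_unorient) auto
  have E: "e \<subseteq> {1..r} \<and> card e = 2" if "e \<in> E" for e using that D by (auto simp: E_def)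
  have I_gen: "ideal_gen (monomial ` m ` {1..r}) = I" and anti: "exp_antichain (m ` {1..r})"
    using gens(2) by (simp_all add: minimal_monomial_generators_iff)
  have "{1..r} \<noteq> {}"
  proof
    assume "{1..r} = {}"
    then have "I = {0}" using I_gen by (simp add: module.span_empty[OF module_mult])
    with I show False by simp
  qed
  then have "is_tree {1..r} E"
    using is_tree_if_resolution[of m E "{1..r}", where 'k='k] inj span E by (simp add: DE)
  moreover have "tree_resolves {1..r} E m I"
    unfolding tree_resolves_def DE
  proof (intro conjI inj equalityI[OF _ span])
    show "tree_d1 m ` free_on {1..r} = I" by (simp only: tree_d1_image I_gen)
    show "tree_d2 m ` free_on D \<subseteq> {v \<in> free_on {1..r}. tree_d1 m v = (0 :: ('x \<Rightarrow>\<^sub>0 nat) \<Rightarrow>\<^sub>0 'k)}"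
    proof (rule image_subsetI)
      fix w :: "nat \<times> nat \<Rightarrow>\<^sub>0 (('x \<Rightarrow>\<^sub>0 nat) \<Rightarrow>\<^sub>0 'k)" assume "w \<in> free_on D"
      then have "tree_d2 m w \<in> free_on {1..r}" by (rule tree_d2_in_free_on) (use D in auto)
      then show "tree_d2 m w \<in> {v \<in> free_on {1..r}. tree_d1 m v = 0}" by (simp add: tree_d1_tree_d2)
    qed
  qed
  moreover have "0 \<notin> m ` {1..r}"
  proof
    assume "0 \<in> m ` {1..r}"
    then have "p \<in> I" for p
      unfolding I_gen[symmetric] mem_ideal_gen_monomial_iff by (metis zero_divides_exp)
    then have "I = UNIV" by blast
    with I show False by simp
  qed
  then have "tree_minimal TYPE('k) {1..r} E m"
    by (intro tree_minimal_if_antichain anti gens(1) E)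
  ultimately show ?thesis
    unfolding minimal_resolution_supported_on_tree_def using gens by blast
qed

section \<open>Elimination orders and trees\<close>

text \<open>For squarefree generators this is the leaf condition \<open>F\<^sub>i \<inter> F\<^sub>h \<subseteq> F\<^sub>j\<close> of a quasi-forest, read
on the complements of the facets.\<close>

definition lcm_elim_order :: "('x \<Rightarrow>\<^sub>0 nat) list \<Rightarrow> bool" where
  "lcm_elim_order ts \<longleftrightarrow> distinct ts \<and>
     (\<forall>i<length ts. 0 < i \<longrightarrow> (\<exists>j<i. \<forall>h<i. ts ! j \<preceq> lcm_exp (ts ! i) (ts ! h)))"

text \<open>Each generator but the first is joined to the predecessor that the order provides.\<close>

lemma minimal_resolution_if_elim_order:
  fixes I :: "(('x \<Rightarrow>\<^sub>0 nat) \<Rightarrow>\<^sub>0 'k::field) set"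
  assumes I: "I \<noteq> {0}" "I \<noteq> UNIV"
    and gens: "minimal_monomial_generators I (set ts)" and elim: "lcm_elim_order ts"
  shows "minimal_resolution_supported_on_tree I"
proof -
  define r where "r = length ts"
  \<comment> \<open>Vertices are numbered from \<open>1\<close>, list positions from \<open>0\<close>.\<close>
  define m where "m i = ts ! (i - 1)" for i
  have "bij_betw ((!) ts) {..<r} (set ts)"
    using elim by (simp add: lcm_elim_order_def r_def bij_betw_nth)
  moreover have "bij_betw (\<lambda>i. i - 1) {1..r} {..<r}"
    by (rule bij_betw_byWitness[of _ Suc]) auto
  ultimately have "bij_betw ((!) ts \<circ> (\<lambda>i. i - 1)) {1..r} (set ts)"
    by (rule bij_betw_trans[rotated])
  moreover have "m = (!) ts \<circ> (\<lambda>i. i - 1)" by (simp add: m_def fun_eq_iff)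
  ultimately have m: "inj_on m {1..r}" "m ` {1..r} = set ts"
    by (simp_all only: bij_betw_def)
  have "\<exists>q. 1 \<le> q \<and> q < i \<and> (\<forall>h\<in>{1..<i}. m q \<preceq> lcm_exp (m i) (m h))"
    if i: "1 < i" "i \<le> r" for i
  proof -
    have "i - 1 < length ts" "0 < i - 1" using i by (auto simp: r_def)
    then obtain j where j: "j < i - 1" "\<forall>h<i - 1. ts ! j \<preceq> lcm_exp (ts ! (i - 1)) (ts ! h)"
      using elim unfolding lcm_elim_order_def by blast
    have "m (Suc j) \<preceq> lcm_exp (m i) (m h)" if "h \<in> {1..<i}" for h
      using j(2)[rule_format, of "h - 1"] that by (simp add: m_def diff_less_mono)
    then show ?thesis using j(1) by (intro exI[of _ "Suc j"]) auto
  qed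
  then obtain q where q: "\<And>i. 1 < i \<Longrightarrow> i \<le> r \<Longrightarrow>
      1 \<le> q i \<and> q i < i \<and> (\<forall>h\<in>{1..<i}. m (q i) \<preceq> lcm_exp (m i) (m h))" by metis
  define D where "D = {(q i, i) | i. 1 < i \<and> i \<le> r}"
  show ?thesis
  proof (rule minimal_resolution_if_exact[OF I m(1)])
    show "minimal_monomial_generators I (m ` {1..r})" using gens m(2) by simp
    show "D \<subseteq> {(i, j). 1 \<le> i \<and> i < j \<and> j \<le> r}" using q by (auto simp: D_def)
    show "inj_on (tree_d2 m :: (nat \<times> nat \<Rightarrow>\<^sub>0 (('x \<Rightarrow>\<^sub>0 nat) \<Rightarrow>\<^sub>0 'k)) \<Rightarrow> _) (free_on D)"
      by (rule inj_tree_d2_if_single_parent) (use q in \<open>auto simp: D_def\<close>)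
    show "{v \<in> free_on {1..r}. tree_d1 m v = (0 :: ('x \<Rightarrow>\<^sub>0 nat) \<Rightarrow>\<^sub>0 'k)} \<subseteq> tree_d2 m ` free_on D"
    proof (rule kernel_in_image_if_elimination)
      fix h i :: nat assume hi: "1 \<le> h" "h < i" "i \<le> r"
      then have "(q i, i) \<in> D \<and> 1 \<le> q i \<and> q i < i \<and> m (q i) \<preceq> lcm_exp (m i) (m h)"
        using q[of i] by (auto simp: D_def)
      then show "\<exists>p. (p, i) \<in> D \<and> 1 \<le> p \<and> p < i \<and> m p \<preceq> lcm_exp (m i) (m h)" by blast
    qed
  qed
qed

lemma rtrancl_crossing_edge:
  assumes "(a, b) \<in> R\<^sup>*" "a \<in> A" "b \<notin> A"
  shows "\<exists>x y. (x, y) \<in> R \<and> x \<in> A \<and> y \<notin> A"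
  using assms by (induction rule: rtrancl_induct) blast+

text \<open>The vertices are listed so that every initial segment is connected in the tree. A new vertex
\<open>i\<close> is joined to the segment by an edge \<open>{p, i}\<close>, and \<open>p\<close> is the required predecessor: if \<open>m\<^sub>p\<close> did
not divide \<open>lcm m\<^sub>i m\<^sub>h\<close>, the path from \<open>i\<close> to \<open>h\<close> below this lcm would avoid \<open>p\<close>, and continuing it
inside the segment from \<open>h\<close> to \<open>p\<close> would give a detour around the edge \<open>{p, i}\<close>.\<close>

lemma elim_order_if_tree_resolves:
  fixes m :: "nat \<Rightarrow> ('x \<Rightarrow>\<^sub>0 nat)" and I :: "(('x \<Rightarrow>\<^sub>0 nat) \<Rightarrow>\<^sub>0 'k::field) set"
  assumes tree: "is_tree V E" "finite V" and res: "tree_resolves V E m I" and inj: "inj_on m V"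
  shows "\<exists>ts. set ts = m ` V \<and> lcm_elim_order ts"
proof -
  have E: "e \<subseteq> V \<and> card e = 2" if "e \<in> E" for e using tree that by (auto simp: is_tree_def)
  have inj2: "inj_on (tree_d2 m :: (nat \<times> nat \<Rightarrow>\<^sub>0 (('x \<Rightarrow>\<^sub>0 nat) \<Rightarrow>\<^sub>0 'k)) \<Rightarrow> _) (free_on (oriented_edges E))"
    using res unfolding tree_resolves_def by blast
  have span: "{v \<in> free_on V. tree_d1 m v = (0 :: ('x \<Rightarrow>\<^sub>0 nat) \<Rightarrow>\<^sub>0 'k)} \<subseteq>
      tree_d2 m ` free_on (oriented_edges E)"
    using res unfolding tree_resolves_def by blast
  have grow: "\<exists>vs. distinct vs \<and> length vs = Suc n \<and> set vs \<subseteq> V \<and>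
      (\<forall>a\<in>set vs. \<forall>b\<in>set vs. (a, b) \<in> {(x, y). {x, y} \<in> E \<and> x \<in> set vs \<and> y \<in> set vs}\<^sup>*) \<and>
      (\<forall>i<length vs. 0 < i \<longrightarrow> (\<exists>j<i. \<forall>h<i. m (vs ! j) \<preceq> lcm_exp (m (vs ! i)) (m (vs ! h))))"
    if "n < card V" for n
    using that
  proof (induction n)
    case 0
    obtain v where "v \<in> V" using tree(1) by (auto simp: is_tree_def)
    then show ?case by (intro exI[of _ "[v]"]) auto
  next
    case (Suc n)
    then obtain vs where vs: "distinct vs" "length vs = Suc n" "set vs \<subseteq> V"
      and conn: "\<And>a b. a \<in> set vs \<Longrightarrow> b \<in> set vs \<Longrightarrow>
        (a, b) \<in> {(x, y). {x, y} \<in> E \<and> x \<in> set vs \<and> y \<in> set vs}\<^sup>*"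
      and elim: "\<And>i. i < length vs \<Longrightarrow> 0 < i \<Longrightarrow>
        \<exists>j<i. \<forall>h<i. m (vs ! j) \<preceq> lcm_exp (m (vs ! i)) (m (vs ! h))"
      by auto
    have "card (set vs) = Suc n" using vs(1,2) by (simp add: distinct_card)
    then have "set vs \<noteq> V" using Suc.prems by auto
    then obtain b where b: "b \<in> V" "b \<notin> set vs" using vs(3) by blast
    obtain a where a: "a \<in> set vs" using vs(2) by (cases vs) auto
    have "(a, b) \<in> {(a, b). {a, b} \<in> E}\<^sup>*" using tree(1) a b vs(3) unfolding is_tree_def by blast
    then obtain p i where pi: "{p, i} \<in> E" "p \<in> set vs" "i \<notin> set vs"
      using rtrancl_crossing_edge[OF _ a b(2)] by blast
    have i: "i \<in> V" using E[OF pi(1)] by simp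
    define vs' where "vs' = vs @ [i]"
    have set_vs': "set vs' = insert i (set vs)" by (simp add: vs'_def)
    let ?R' = "{(x, y). {x, y} \<in> E \<and> x \<in> set vs' \<and> y \<in> set vs'}"
    have conn': "(a, b) \<in> ?R'\<^sup>*" if "a \<in> set vs" "b \<in> set vs" for a b
      by (rule rev_subsetD[OF conn[OF that] rtrancl_mono]) (auto simp: set_vs')
    have pi': "(p, i) \<in> ?R'" "(i, p) \<in> ?R'" using pi by (auto simp: set_vs' insert_commute)
    have conn'': "(a, b) \<in> ?R'\<^sup>*" if "a \<in> set vs'" "b \<in> set vs'" for a b
    proof -
      have "(a, p) \<in> ?R'\<^sup>*" if "a \<in> set vs'" for a
        using that conn'[OF _ pi(2)] pi'(2) unfolding set_vs' by blast
      moreover have "(p, b) \<in> ?R'\<^sup>*" if "b \<in> set vs'" for b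
        using that conn'[OF pi(2)] pi'(1) unfolding set_vs' by blast
      ultimately show ?thesis using that by (meson rtrancl_trans)
    qed
    have key: "m p \<preceq> lcm_exp (m i) (m h)" if h: "h \<in> set vs" for h
    proof (rule ccontr)
      assume not: "\<not> m p \<preceq> lcm_exp (m i) (m h)"
      let ?R = "{(a, b). {a, b} \<in> E - {{i, p}}}"
      have "(i, h) \<in> ?R\<^sup>*"
        by (rule rev_subsetD[OF connected_below_lcm[OF span i _ refl] rtrancl_mono])
           (use not h vs(3) in \<open>auto simp: doubleton_eq_iff\<close>)
      moreover have "(h, p) \<in> ?R\<^sup>*"
        by (rule rev_subsetD[OF conn[OF h pi(2)] rtrancl_mono]) (use pi(3) in \<open>auto simp: doubleton_eq_iff\<close>)
      ultimately have "(i, p) \<in> ?R\<^sup>*" by (rule rtrancl_trans)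
      then show False
        using bridge_if_inj[OF inj2 tree(2) E, of i p] pi(1) by (simp add: insert_commute)
    qed
    obtain k where k: "k < Suc n" "vs ! k = p" using pi(2) vs(2) by (metis in_set_conv_nth)
    have "\<exists>j<l. \<forall>h<l. m (vs' ! j) \<preceq> lcm_exp (m (vs' ! l)) (m (vs' ! h))"
      if l: "l < length vs'" "0 < l" for l
    proof (cases "l < length vs")
      case True
      then obtain j where "j < l" "\<forall>h<l. m (vs ! j) \<preceq> lcm_exp (m (vs ! l)) (m (vs ! h))"
        using elim l by blast
      then show ?thesis using True by (intro exI[of _ j]) (auto simp: vs'_def nth_append)
    next
      case False
      then have "l = Suc n" using l vs(2) by (simp add: vs'_def)
      then show ?thesis using k vs(2) key by (intro exI[of _ k]) (auto simp: vs'_def nth_append)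
    qed
    then show ?case using vs pi(3) i conn'' by (intro exI[of _ vs']) (auto simp: vs'_def)
  qed
  have "V \<noteq> {}" using tree(1) by (simp add: is_tree_def)
  then have "card V - 1 < card V" "Suc (card V - 1) = card V" using tree(2) by (simp_all add: card_gt_0_iff)
  then obtain vs where vs: "distinct vs" "length vs = card V" "set vs \<subseteq> V"
     "\<forall>i<length vs. 0 < i \<longrightarrow> (\<exists>j<i. \<forall>h<i. m (vs ! j) \<preceq> lcm_exp (m (vs ! i)) (m (vs ! h)))"
    using grow[of "card V - 1"] by auto
  have "set vs = V" using vs(1-3) tree(2) by (intro card_subset_eq) (simp_all add: distinct_card)
  moreover have "\<exists>j<i. \<forall>h<i. map m vs ! j \<preceq> lcm_exp (map m vs ! i) (map m vs ! h)"
    if i: "i < length (map m vs)" "0 < i" for i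
  proof -
    obtain j where "j < i" "\<forall>h<i. m (vs ! j) \<preceq> lcm_exp (m (vs ! i)) (m (vs ! h))"
      using vs(4) i by auto
    then show ?thesis using i by (intro exI[of _ j]) auto
  qed
  ultimately show ?thesis
    using vs(1) inj by (intro exI[of _ "map m vs"]) (auto simp: lcm_elim_order_def distinct_map)
qed

section \<open>Short free resolutions bound the projective dimension\<close>

lemma lookup_map_key:
  "inj f \<Longrightarrow> Poly_Mapping.lookup (Poly_Mapping.map_key f p) i = Poly_Mapping.lookup p (f i)"
  by (simp add: map_key.rep_eq)

lemma module_hom_map_key:
  fixes f :: "'c \<Rightarrow> 'u"
  assumes "inj f"
  shows "module_hom fscale fscale (Poly_Mapping.map_key f :: ('u \<Rightarrow>\<^sub>0 'a::comm_ring_1) \<Rightarrow> _)"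
  unfolding module_hom_iff
  by (auto simp: module_fscale map_key_plus[OF assms] lookup_fscale lookup_map_key[OF assms]
      intro!: poly_mapping_eqI)

text \<open>The inverse of the pullback \<open>map_key f\<close> on vectors supported in the range of \<open>f\<close>.\<close>

definition push_key :: "('c \<Rightarrow> 'u) \<Rightarrow> ('c \<Rightarrow>\<^sub>0 'a::comm_ring_1) \<Rightarrow> ('u \<Rightarrow>\<^sub>0 'a)" where
  "push_key f = lin_ext fscale (\<lambda>i. basis_vec (f i))"

lemma push_key_in_free_on: "v \<in> free_on V \<Longrightarrow> push_key f v \<in> free_on (f ` V)"
  unfolding push_key_def
  by (rule lin_ext_mem[OF module_fscale subspace_free_on]) (auto simp: free_on_def)

lemma map_key_in_free_on:
  "inj f \<Longrightarrow> x \<in> free_on (f ` V) \<Longrightarrow> Poly_Mapping.map_key f x \<in> free_on V"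
  using inj_image_mem_iff[of f _ V] by (auto simp: free_on_def keys_map_key)

lemma lookup_push_key:
  assumes "inj f"
  shows "Poly_Mapping.lookup (push_key f v) (f i) = Poly_Mapping.lookup v i"
proof -
  have "Poly_Mapping.lookup (push_key f v) (f i) =
      (\<Sum>c\<in>Poly_Mapping.keys v. if c = i then Poly_Mapping.lookup v c else 0)"
    unfolding push_key_def lin_ext_def lookup_sum
    by (intro sum.cong) (auto simp: lookup_fscale lookup_single inj_eq[OF assms])
  also have "\<dots> = Poly_Mapping.lookup v i"
    by (simp add: sum.delta in_keys_iff)
  finally show ?thesis .
qed

lemma map_key_push_key: "inj f \<Longrightarrow> Poly_Mapping.map_key f (push_key f v) = v"
  by (rule poly_mapping_eqI) (simp add: lookup_map_key lookup_push_key)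

lemma push_key_map_key:
  assumes "inj f" "x \<in> free_on (f ` V)"
  shows "push_key f (Poly_Mapping.map_key f x) = x"
proof (rule poly_mapping_eqI)
  fix u
  show "Poly_Mapping.lookup (push_key f (Poly_Mapping.map_key f x)) u = Poly_Mapping.lookup x u"
  proof (cases "u \<in> f ` V")
    case True
    then obtain i where "u = f i" by blast
    then show ?thesis by (simp add: lookup_push_key[OF assms(1)] lookup_map_key[OF assms(1)])
  next
    case False
    have "push_key f (Poly_Mapping.map_key f x) \<in> free_on (f ` V)"
      by (intro push_key_in_free_on map_key_in_free_on assms)
    then have "u \<notin> Poly_Mapping.keys (push_key f (Poly_Mapping.map_key f x))" "u \<notin> Poly_Mapping.keys x"
      using False assms(2) unfolding free_on_def by blast+
    then show ?thesis by (simp add: in_keys_iff)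
  qed
qed

text \<open>Resolutions that define the projective dimension live in free modules on \<open>'u\<close>, so the two index
types are embedded into \<open>'u\<close> and the maps are conjugated by the reindexing isomorphisms.\<close>

lemma proj_dim_le_1_if_free_resolution:
  fixes s :: "'a::comm_ring_1 \<Rightarrow> 'b::ab_group_add \<Rightarrow> 'b"
    and \<alpha> :: "('v::countable \<Rightarrow>\<^sub>0 'a) \<Rightarrow> 'b" and \<beta> :: "('e::countable \<Rightarrow>\<^sub>0 'a) \<Rightarrow> ('v \<Rightarrow>\<^sub>0 'a)"
  assumes \<alpha>: "module_hom fscale s \<alpha>" "\<alpha> ` free_on V = M"
    and \<beta>: "module_hom fscale fscale \<beta>" "\<beta> ` free_on D = {v \<in> free_on V. \<alpha> v = 0}"
      "inj_on \<beta> (free_on D)"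
  shows "proj_dim TYPE('u::infinite) s M \<le> 1"
proof -
  interpret F: module "fscale :: 'a \<Rightarrow> ('u \<Rightarrow>\<^sub>0 'a) \<Rightarrow> _" by (rule module_fscale)
  interpret \<beta>: module_hom fscale fscale \<beta> by fact
  obtain e :: "nat \<Rightarrow> 'u" where e: "inj e"
    using infinite_countable_subset[of "UNIV :: 'u set"] infinite_UNIV by auto
  define f :: "'v \<Rightarrow> 'u" where "f = e \<circ> to_nat"
  define g :: "'e \<Rightarrow> 'u" where "g = e \<circ> to_nat"
  have f: "inj f" and g: "inj g" using e by (simp_all add: f_def g_def inj_compose)
  let ?f = "Poly_Mapping.map_key f :: ('u \<Rightarrow>\<^sub>0 'a) \<Rightarrow> _"
  let ?g = "Poly_Mapping.map_key g :: ('u \<Rightarrow>\<^sub>0 'a) \<Rightarrow> _"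
  let ?push = "push_key f :: ('v \<Rightarrow>\<^sub>0 'a) \<Rightarrow> ('u \<Rightarrow>\<^sub>0 'a)"
  define B where "B i = (if i = 0 then f ` V else if i = 1 then g ` D else {})" for i :: nat
  define P where "P i = (free_on (B i) :: ('u \<Rightarrow>\<^sub>0 'a) set)" for i
  define d1 where "d1 x = ?push (\<beta> (?g x))" for x
  define d where "d i = (if i = 1 then d1 else (\<lambda>_. 0))" for i :: nat
  have fV: "?f ` P 0 = free_on V"
  proof (intro antisym subsetI)
    fix v :: "'v \<Rightarrow>\<^sub>0 'a" assume "v \<in> free_on V"
    then show "v \<in> ?f ` P 0"
      using push_key_in_free_on[of v V f] map_key_push_key[OF f, of v]
      by (intro image_eqI[of _ _ "push_key f v"]) (auto simp: P_def B_def)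
  qed (use map_key_in_free_on[OF f] in \<open>auto simp: P_def B_def\<close>)
  have gD: "?g ` P 1 = free_on D"
  proof (intro antisym subsetI)
    fix v :: "'e \<Rightarrow>\<^sub>0 'a" assume "v \<in> free_on D"
    then show "v \<in> ?g ` P 1"
      using push_key_in_free_on[of v D g] map_key_push_key[OF g, of v]
      by (intro image_eqI[of _ _ "push_key g v"]) (auto simp: P_def B_def)
  qed (use map_key_in_free_on[OF g] in \<open>auto simp: P_def B_def\<close>)
  have P_zero: "P i = {0}" if "i > 1" for i using that by (auto simp: P_def B_def free_on_def)
  have ker: "x \<in> P 0 \<and> \<alpha> (?f x) = 0 \<longleftrightarrow> x \<in> ?push ` {v \<in> free_on V. \<alpha> v = 0}" for x
  proof
    assume x: "x \<in> P 0 \<and> \<alpha> (?f x) = 0"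
    then have "?f x \<in> free_on V" "x = ?push (?f x)"
      using fV push_key_map_key[OF f, of x V] by (auto simp: P_def B_def)
    with x show "x \<in> ?push ` {v \<in> free_on V. \<alpha> v = 0}" by blast
  next
    assume "x \<in> ?push ` {v \<in> free_on V. \<alpha> v = 0}"
    then obtain v where "v \<in> free_on V" "\<alpha> v = 0" "x = ?push v" by blast
    then show "x \<in> P 0 \<and> \<alpha> (?f x) = 0"
      using push_key_in_free_on[of v V f] by (simp add: P_def B_def map_key_push_key[OF f])
  qed
  have d1_image: "d1 ` P 1 = {x \<in> P 0. \<alpha> (?f x) = 0}"
  proof -
    have "d1 ` P 1 = ?push ` \<beta> ` ?g ` P 1" by (simp add: d1_def image_image)
    also have "\<dots> = {x \<in> P 0. \<alpha> (?f x) = 0}"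
      unfolding gD \<beta>(2) using ker by blast
    finally show ?thesis .
  qed
  have hom_d1: "module_hom fscale fscale d1"
    using module_hom_compose[OF module_hom_compose[OF module_hom_map_key[OF g] \<beta>(1)]
        module_hom_lin_ext[OF module_fscale, of "\<lambda>i. basis_vec (f i)"]]
    by (simp add: d1_def[abs_def] push_key_def comp_def)
  interpret d1: module_hom fscale fscale d1 by (rule hom_d1)
  have d1_ker: "x = 0" if "x \<in> P 1" "d1 x = 0" for x
  proof -
    have gx: "?g x \<in> free_on D" using that(1) gD by blast
    have "?f (?push (\<beta> (?g x))) = ?f 0" using that(2) unfolding d1_def by simp
    then have "\<beta> (?g x) = \<beta> 0" by (simp add: map_key_push_key[OF f] map_key_zero[OF f] \<beta>.zero)
    then have "?g x = 0"
      using \<beta>(3) gx module.subspace_0[OF module_fscale subspace_free_on] by (meson inj_onD)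
    then have "push_key g (?g x) = 0" by (simp add: push_key_def lin_ext_def)
    then show ?thesis using push_key_map_key[OF g, of x D] that(1) by (simp add: P_def B_def)
  qed
  have "projective_resolution s M P d (\<lambda>x. \<alpha> (?f x))"
    unfolding projective_resolution_def
  proof (intro conjI allI impI)
    fix i
    show "F.subspace (P i)" "projective fscale (P i)"
      by (simp_all add: P_def subspace_free_on projective_free_on)
  next
    have "module_hom fscale s (\<lambda>x. \<alpha> (?f x))"
      using module_hom_compose[OF module_hom_map_key[OF f] \<alpha>(1)] by (simp add: comp_def)
    then show "linear_between fscale (P 0) s M (\<lambda>x. \<alpha> (?f x))"
      using fV \<alpha>(2) by (intro module_hom_imp_linear_between) auto
    show "(\<lambda>x. \<alpha> (?f x)) ` P 0 = M" using fV \<alpha>(2) by (simp flip: image_image)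
    show "d 1 ` P 1 = {x \<in> P 0. \<alpha> (?f x) = 0}" using d1_image by (simp add: d_def)
  next
    fix i
    show "linear_between fscale (P (i + 1)) fscale (P i) (d (i + 1))"
    proof (cases "i = 0")
      case True
      then show ?thesis
        using d1_image by (auto simp: d_def intro!: module_hom_imp_linear_between hom_d1)
    next
      case False
      then show ?thesis
        by (auto simp: d_def linear_between_def P_def F.subspace_0[OF subspace_free_on])
    qed
  next
    fix i :: nat assume i: "1 \<le> i"
    have "{x \<in> P i. d i x = 0} = {0}"
    proof (cases "i = 1")
      case True
      then show ?thesis
        using d1_ker d1.zero F.subspace_0[OF subspace_free_on] by (auto simp: d_def P_def)
    next
      case False
      then show ?thesis using i P_zero[of i] by (auto simp: d_def)
    qed
    moreover have "P (i + 1) = {0}" using i by (intro P_zero) simp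
    ultimately show "d (i + 1) ` P (i + 1) = {x \<in> P i. d i x = 0}" using i by (simp add: d_def)
  qed
  then show ?thesis
    using P_zero unfolding proj_dim_le_1_iff by blast
qed

section \<open>A tree from projective dimension at most one\<close>

definition total_degree :: "('x::finite \<Rightarrow>\<^sub>0 nat) \<Rightarrow> nat" where
  "total_degree t = (\<Sum>x\<in>UNIV. Poly_Mapping.lookup t x)"

text \<open>Membership in the \<open>n\<close>-th power of the maximal ideal.\<close>

definition order_ge :: "nat \<Rightarrow> (('x::finite \<Rightarrow>\<^sub>0 nat) \<Rightarrow>\<^sub>0 'k::field) \<Rightarrow> bool" where
  "order_ge n p \<longleftrightarrow> (\<forall>t\<in>Poly_Mapping.keys p. n \<le> total_degree t)"

lemma order_ge_mult: "order_ge n p \<Longrightarrow> order_ge k q \<Longrightarrow> order_ge (n + k) (p * q)"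
  unfolding order_ge_def
proof
  fix t assume *: "\<forall>t\<in>Poly_Mapping.keys p. n \<le> total_degree t"
    "\<forall>t\<in>Poly_Mapping.keys q. k \<le> total_degree t" "t \<in> Poly_Mapping.keys (p * q)"
  then obtain a b where "t = a + b" "a \<in> Poly_Mapping.keys p" "b \<in> Poly_Mapping.keys q"
    using Poly_Mapping.keys_mult[of p q] by blast
  with *(1,2) show "n + k \<le> total_degree t"
    by (simp add: total_degree_def lookup_add sum.distrib add_mono)
qed

lemma order_ge_sum: "(\<And>i. i \<in> A \<Longrightarrow> order_ge n (f i)) \<Longrightarrow> order_ge n (\<Sum>i\<in>A. f i)"
  unfolding order_ge_def using keys_sum[of f A] by fast

lemma order_ge_1_iff: "order_ge 1 p \<longleftrightarrow> Poly_Mapping.lookup p 0 = 0"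
proof
  assume "order_ge 1 p"
  then have "0 \<notin> Poly_Mapping.keys p" by (auto simp: order_ge_def total_degree_def)
  then show "Poly_Mapping.lookup p 0 = 0" by (simp add: in_keys_iff)
next
  assume p: "Poly_Mapping.lookup p 0 = 0"
  show "order_ge 1 p" unfolding order_ge_def
  proof
    fix t assume "t \<in> Poly_Mapping.keys p"
    with p have "t \<noteq> 0" by (auto simp: in_keys_iff)
    then obtain x where "Poly_Mapping.lookup t x \<noteq> 0" by (metis lookup_zero poly_mapping_eqI)
    then have "total_degree t \<noteq> 0" by (auto simp: total_degree_def)
    then show "1 \<le> total_degree t" by simp
  qed
qed

lemma eq_0_if_order_ge: "(\<And>n. order_ge n p) \<Longrightarrow> p = 0"
proof (rule ccontr)
  assume *: "\<And>n. order_ge n p" "p \<noteq> 0"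
  then have "Poly_Mapping.keys p \<noteq> {}" by simp
  then obtain t where "t \<in> Poly_Mapping.keys p" by blast
  with *(1)[of "Suc (total_degree t)"] show False by (auto simp: order_ge_def)
qed

text \<open>A substitute for Nakayama's lemma on direct summands of \<open>S\<^sup>D\<close>. If the image \<open>N\<close> of
\<open>\<rho>\<close> lies in \<open>\<m> S\<^sup>D\<close>, then \<open>N = \<rho>(N) \<subseteq> \<m> N\<close>, so the entries of its elements lie in every power of
\<open>\<m>\<close>.\<close>

lemma idempotent_into_max_ideal_eq_0:
  fixes \<rho> :: "('e \<Rightarrow>\<^sub>0 (('x::finite \<Rightarrow>\<^sub>0 nat) \<Rightarrow>\<^sub>0 'k::field)) \<Rightarrow> _"
  assumes lin: "linear_between fscale (free_on D) fscale (free_on D) \<rho>"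
    and idem: "\<And>x. x \<in> free_on D \<Longrightarrow> \<rho> (\<rho> x) = \<rho> x"
    and const: "\<And>x e. x \<in> free_on D \<Longrightarrow> Poly_Mapping.lookup (Poly_Mapping.lookup (\<rho> x) e) 0 = 0"
    and x: "x \<in> free_on D"
  shows "\<rho> x = 0"
proof -
  have "order_ge n (Poly_Mapping.lookup (\<rho> x) e)" if "x \<in> free_on D" for n x e
    using that
  proof (induction n arbitrary: x e)
    case 0
    show ?case by (simp add: order_ge_def)
  next
    case (Suc n)
    have \<rho>x: "\<rho> x \<in> free_on D" using lin Suc.prems by (auto simp: linear_between_def)
    have "\<rho> x = \<rho> (lin_ext fscale basis_vec (\<rho> x))"
      using idem[OF Suc.prems] by (simp add: lin_ext_basis_vec)
    also have "\<dots> = lin_ext fscale (\<lambda>b. \<rho> (basis_vec b)) (\<rho> x)"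
      by (rule linear_between_lin_ext[OF lin module_fscale module_fscale subspace_free_on \<rho>x])
         (rule basis_vec_in_free_on)
    finally have "\<rho> x = lin_ext fscale (\<lambda>b. \<rho> (basis_vec b)) (\<rho> x)" .
    then have "Poly_Mapping.lookup (\<rho> x) e = Poly_Mapping.lookup (lin_ext fscale (\<lambda>b. \<rho> (basis_vec b)) (\<rho> x)) e"
      by (rule arg_cong)
    also have "\<dots> = (\<Sum>b\<in>Poly_Mapping.keys (\<rho> x).
        Poly_Mapping.lookup (\<rho> x) b * Poly_Mapping.lookup (\<rho> (basis_vec b)) e)"
      by (simp add: lin_ext_def lookup_sum lookup_fscale)
    finally have eq: "Poly_Mapping.lookup (\<rho> x) e = (\<Sum>b\<in>Poly_Mapping.keys (\<rho> x).
        Poly_Mapping.lookup (\<rho> x) b * Poly_Mapping.lookup (\<rho> (basis_vec b)) e)" .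
    have "order_ge (1 + n) (Poly_Mapping.lookup (\<rho> x) e)"
      unfolding eq
    proof (intro order_ge_sum order_ge_mult)
      fix b assume "b \<in> Poly_Mapping.keys (\<rho> x)"
      then have "basis_vec b \<in> free_on D" using \<rho>x by (auto simp: free_on_def)
      then show "order_ge n (Poly_Mapping.lookup (\<rho> (basis_vec b)) e)" by (rule Suc.IH)
      show "order_ge 1 (Poly_Mapping.lookup (\<rho> x) b)"
        using const[OF Suc.prems] by (simp only: order_ge_1_iff)
    qed
    then show ?case by simp
  qed
  then have "Poly_Mapping.lookup (\<rho> x) e = 0" for e using x by (intro eq_0_if_order_ge)
  then show ?thesis by (intro poly_mapping_eqI[of "\<rho> x" 0]) simp
qed

text \<open>When the basis vector of an edge with lcm \<open>l\<close> is placed in degree \<open>l\<close>, this is the part of its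
coefficient that contributes to degree \<open>L\<close>.\<close>

definition hom_part ::
  "('x \<Rightarrow>\<^sub>0 nat) \<Rightarrow> ('x \<Rightarrow>\<^sub>0 nat) \<Rightarrow> (('x \<Rightarrow>\<^sub>0 nat) \<Rightarrow>\<^sub>0 'k::field) \<Rightarrow> (('x \<Rightarrow>\<^sub>0 nat) \<Rightarrow>\<^sub>0 'k)" where
  "hom_part L l p = (if l \<preceq> L then Poly_Mapping.single (L - l) (Poly_Mapping.lookup p (L - l)) else 0)"

lemma lookup_hom_part_mult:
  assumes "s \<preceq> l"
  shows "Poly_Mapping.lookup (hom_part L l p * monomial (l - s)) t =
    (if t + s = L then Poly_Mapping.lookup (p * monomial (l - s)) t else 0)"
proof (cases "l \<preceq> L")
  case True
  have L: "L - l + (l - s) + s = L" using True assms by (simp add: add.assoc diff_add_exp)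
  then have "t = L - l + (l - s) \<longleftrightarrow> t + s = L" by (metis add_right_cancel)
  then show ?thesis
    using True by (auto simp: hom_part_def single_mult_monomial lookup_single when_def)
next
  case False
  then show ?thesis
    using assms by (auto simp: hom_part_def lookup_mult_monomial diff_exp_divides_iff)
qed

text \<open>The differential \<open>d\<^sub>2\<close> is homogeneous when vertex \<open>i\<close> sits in degree \<open>m\<^sub>i\<close>.\<close>

lemma lookup_hom_part_syz:
  "Poly_Mapping.lookup (hom_part L (lcm_exp (m a) (m b)) p * Poly_Mapping.lookup (syz m (a, b)) i) t =
    (if t + m i = L then Poly_Mapping.lookup (p * Poly_Mapping.lookup (syz m (a, b)) i) t else 0)"
  using lookup_hom_part_mult[of "m i" "lcm_exp (m a) (m b)" L p t]
  by (auto simp: lookup_syz right_diff_distrib lookup_minus)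

text \<open>The homogeneous part of the relation in the degree of \<open>e\<close> is again a relation, and there the
coefficient of \<open>e\<close> is a nonzero constant, so the relation can be solved for the syzygy of \<open>e\<close>.\<close>

lemma syz_redundant_if_unit_coefficient:
  fixes w :: "nat \<times> nat \<Rightarrow>\<^sub>0 (('x \<Rightarrow>\<^sub>0 nat) \<Rightarrow>\<^sub>0 'k::field)"
  assumes w: "w \<in> free_on D" "tree_d2 m w = 0"
    and e: "Poly_Mapping.lookup (Poly_Mapping.lookup w e) 0 \<noteq> 0"
  shows "(syz m e :: nat \<Rightarrow>\<^sub>0 (('x \<Rightarrow>\<^sub>0 nat) \<Rightarrow>\<^sub>0 'k)) \<in> tree_d2 m ` free_on (D - {e})"
proof -
  interpret d2: module_hom fscale fscale "tree_d2 m :: _ \<Rightarrow> nat \<Rightarrow>\<^sub>0 (('x \<Rightarrow>\<^sub>0 nat) \<Rightarrow>\<^sub>0 'k)"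
    by (rule module_hom_tree_d2)
  let ?l = "\<lambda>e. lcm_exp (m (fst e)) (m (snd e))"
  define L where "L = ?l e"
  define c where "c = Poly_Mapping.lookup (Poly_Mapping.lookup w e) 0"
  have eK: "e \<in> Poly_Mapping.keys w" using e by (auto simp: in_keys_iff)
  define h where "h f = hom_part L (?l f) (Poly_Mapping.lookup w f)" for f
  define u where "u = (\<Sum>f\<in>Poly_Mapping.keys w - {e}. Poly_Mapping.single f (h f))"
  \<comment> \<open>The degree \<open>L\<close> is that of \<open>e\<close> itself, so only the constant term of its coefficient survives.\<close>
  have he: "h e = Poly_Mapping.single 0 c"
    by (simp add: h_def hom_part_def L_def c_def)
  have u: "u \<in> free_on (D - {e})"
    unfolding u_def using w(1)
    by (intro d2.m1.subspace_sum subspace_free_on) (auto simp: free_on_def)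
  have total: "(\<Sum>f\<in>Poly_Mapping.keys w. fscale (h f) (syz m f)) = (0 :: nat \<Rightarrow>\<^sub>0 (('x \<Rightarrow>\<^sub>0 nat) \<Rightarrow>\<^sub>0 'k))"
  proof (intro poly_mapping_eqI)
    fix i t
    have "Poly_Mapping.lookup (Poly_Mapping.lookup (\<Sum>f\<in>Poly_Mapping.keys w. fscale (h f) (syz m f)) i) t =
        (\<Sum>f\<in>Poly_Mapping.keys w. Poly_Mapping.lookup (h f * Poly_Mapping.lookup (syz m f) i) t)"
      by (simp add: lookup_sum lookup_fscale)
    also have "\<dots> = (\<Sum>f\<in>Poly_Mapping.keys w. if t + m i = L
        then Poly_Mapping.lookup (Poly_Mapping.lookup w f * Poly_Mapping.lookup (syz m f) i) t else 0)"
      unfolding h_def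
      by (intro sum.cong refl, subst (1 2) prod.collapse[symmetric], subst lookup_hom_part_syz) simp
    also have "\<dots> = (if t + m i = L then Poly_Mapping.lookup (Poly_Mapping.lookup (tree_d2 m w) i) t else 0)"
      by (simp add: lookup_tree_d2 lookup_sum)
    finally show "Poly_Mapping.lookup (Poly_Mapping.lookup (\<Sum>f\<in>Poly_Mapping.keys w. fscale (h f) (syz m f)) i) t =
        Poly_Mapping.lookup (Poly_Mapping.lookup (0 :: nat \<Rightarrow>\<^sub>0 (('x \<Rightarrow>\<^sub>0 nat) \<Rightarrow>\<^sub>0 'k)) i) t"
      by (simp add: w(2))
  qed
  have "tree_d2 m u = (\<Sum>f\<in>Poly_Mapping.keys w - {e}. fscale (h f) (syz m f))"
    by (simp add: u_def d2.sum tree_d2_single)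
  then have "tree_d2 m u = - fscale (Poly_Mapping.single 0 c) (syz m e)"
    using total eK by (simp add: sum.remove he add_eq_0_iff)
  then have "tree_d2 m (fscale (Poly_Mapping.single 0 (- inverse c)) u) =
      fscale (Poly_Mapping.single 0 (- inverse c)) (- fscale (Poly_Mapping.single 0 c) (syz m e))"
    by (simp add: d2.scale)
  also have "\<dots> = - fscale (Poly_Mapping.single 0 (- inverse c) * Poly_Mapping.single 0 c) (syz m e)"
    by (simp only: d2.m2.scale_minus_right d2.m2.scale_scale)
  also have "Poly_Mapping.single 0 (- inverse c) * Poly_Mapping.single 0 c = (-1 :: ('x \<Rightarrow>\<^sub>0 nat) \<Rightarrow>\<^sub>0 'k)"
    using e by (simp add: mult_single c_def single_uminus)
  also have "- fscale (-1) (syz m e) = (syz m e :: nat \<Rightarrow>\<^sub>0 (('x \<Rightarrow>\<^sub>0 nat) \<Rightarrow>\<^sub>0 'k))"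
    by (simp only: d2.m2.scale_minus_left d2.m2.scale_one minus_minus)
  finally show ?thesis
    using d2.m1.subspace_scale[OF subspace_free_on u] by (metis imageI)
qed

text \<open>The endomorphism \<open>\<rho> = id - \<sigma> \<circ> d\<^sub>2\<close> projects onto \<open>ker d\<^sub>2\<close>. As \<open>D\<close> has least
cardinality among the generating sets of pairs, no relation among its syzygies has a coefficient with
a nonzero constant term, so \<open>\<rho>\<close> takes values in \<open>\<m> S\<^sup>D\<close> and vanishes.\<close>

lemma minimal_resolution_if_proj_dim_le_1:
  fixes I :: "(('x::finite \<Rightarrow>\<^sub>0 nat) \<Rightarrow>\<^sub>0 'k::field) set"
  assumes I: "I \<noteq> {0}" "I \<noteq> UNIV" and gens: "minimal_monomial_generators I G" "finite G"
    and pd: "proj_dim TYPE('u) (*) I \<le> 1"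
  shows "minimal_resolution_supported_on_tree I"
proof -
  let ?d2 = "\<lambda>m. tree_d2 m :: _ \<Rightarrow> nat \<Rightarrow>\<^sub>0 (('x \<Rightarrow>\<^sub>0 nat) \<Rightarrow>\<^sub>0 'k)"
  obtain m where "bij_betw m {1..card G} G"
    using ex_bij_betw_nat_finite_1[OF gens(2)] by blast
  then obtain r where m: "inj_on m {1..r}" "m ` {1..r} = G" by (auto simp: bij_betw_def)
  define K where "K = {v \<in> free_on {1..r}. tree_d1 m v = (0 :: ('x \<Rightarrow>\<^sub>0 nat) \<Rightarrow>\<^sub>0 'k)}"
  define pairs where "pairs = {(i, j). 1 \<le> i \<and> i < j \<and> j \<le> r}"
  have "finite pairs" by (rule finite_subset[of _ "{1..r} \<times> {1..r}"]) (auto simp: pairs_def)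
  \<comment> \<open>Generating sets are taken among the pairwise syzygies, all of which together generate \<open>K\<close>.\<close>
  define spanning where "spanning D \<longleftrightarrow> D \<subseteq> pairs \<and> K \<subseteq> ?d2 m ` free_on D" for D
  have "spanning pairs"
    unfolding spanning_def K_def
  proof (intro conjI order_refl kernel_in_image_if_elimination)
    fix h i :: nat assume "1 \<le> h" "h < i" "i \<le> r"
    then show "\<exists>p. (p, i) \<in> pairs \<and> 1 \<le> p \<and> p < i \<and> m p \<preceq> lcm_exp (m i) (m h)"
      by (intro exI[of _ h]) (auto simp: pairs_def)
  qed
  then obtain D where "spanning D" and least: "\<And>D'. spanning D' \<Longrightarrow> card D \<le> card D'"
    using ex_has_least_nat[of spanning pairs card] by blast
  then have D: "D \<subseteq> pairs" "K \<subseteq> ?d2 m ` free_on D" by (simp_all add: spanning_def)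
  have "finite D" using D(1) \<open>finite pairs\<close> by (rule finite_subset)
  have DV: "a \<in> {1..r} \<and> b \<in> {1..r}" if "(a, b) \<in> D" for a b
    using that D(1) by (auto simp: pairs_def)
  have d2_in: "tree_d2 m w \<in> free_on {1..r}" if "w \<in> free_on D" for w :: "_ \<Rightarrow>\<^sub>0 (('x \<Rightarrow>\<^sub>0 nat) \<Rightarrow>\<^sub>0 'k)"
    using tree_d2_in_free_on[OF that DV] .
  have im: "?d2 m ` free_on D = K"
    using D(2) d2_in by (auto simp: K_def tree_d1_tree_d2)
  have I_eq: "tree_d1 m ` free_on {1..r} = I"
    using gens(1) by (simp only: tree_d1_image m(2) minimal_monomial_generators_iff)
  obtain P :: "nat \<Rightarrow> ('u \<Rightarrow>\<^sub>0 (('x \<Rightarrow>\<^sub>0 nat) \<Rightarrow>\<^sub>0 'k)) set" and d \<epsilon>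
    where res: "projective_resolution (*) I P d \<epsilon>" "\<forall>i>1. P i = {0}"
    using pd unfolding proj_dim_le_1_iff by blast
  have d1_lin: "linear_between fscale (free_on {1..r}) (*) I (tree_d1 m)"
    using I_eq by (intro module_hom_imp_linear_between module_hom_tree_d1) simp
  have d2_lin: "linear_between fscale (free_on D) fscale (free_on {1..r}) (?d2 m)"
    using d2_in by (intro module_hom_imp_linear_between module_hom_tree_d2) auto
  obtain \<sigma> where \<sigma>: "linear_between fscale K fscale (free_on D) \<sigma>" "\<And>x. x \<in> K \<Longrightarrow> tree_d2 m (\<sigma> x) = x"
    using section_if_projective_resolution[OF module_mult res d1_lin I_eq module_fscale
        subspace_free_on d2_lin im[unfolded K_def]]
    unfolding K_def[symmetric] by blast
  interpret d2: module_hom fscale fscale "?d2 m" by (rule module_hom_tree_d2)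
  interpret d1: module_hom fscale "(*)" "tree_d1 m :: _ \<Rightarrow> ('x \<Rightarrow>\<^sub>0 nat) \<Rightarrow>\<^sub>0 'k"
    by (rule module_hom_tree_d1)
  have K_sub: "d2.m2.subspace K"
    unfolding im[symmetric] by (rule d2.subspace_image[OF subspace_free_on])
  have \<sigma>0: "\<sigma> 0 = 0" by (rule linear_between_0[OF \<sigma>(1) module_fscale module_fscale K_sub])
  define \<rho> where "\<rho> x = x - \<sigma> (tree_d2 m x)" for x
  have d2K: "tree_d2 m x \<in> K" if "x \<in> free_on D" for x using im that by blast
  have \<rho>_in: "\<rho> x \<in> free_on D" if "x \<in> free_on D" for x
    unfolding \<rho>_def using \<sigma>(1) d2K[OF that] that
    by (intro d2.m1.subspace_diff[OF subspace_free_on]) (auto simp: linear_between_def)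
  have d2_\<rho>: "tree_d2 m (\<rho> x) = 0" if "x \<in> free_on D" for x
    using \<sigma>(2)[OF d2K[OF that]] by (simp add: \<rho>_def d2.diff)
  have ker_\<rho>: "\<rho> x = x" if "tree_d2 m x = 0" for x using that \<sigma>0 by (simp add: \<rho>_def)
  have "linear_between fscale (free_on D) fscale (free_on D) \<rho>"
    using \<rho>_in \<sigma>(1) d2K
    by (simp add: linear_between_def \<rho>_def image_subset_iff d2.add d2.scale d2.m1.scale_right_diff_distrib)
  moreover have "\<rho> (\<rho> x) = \<rho> x" if "x \<in> free_on D" for x
    by (rule ker_\<rho>[OF d2_\<rho>[OF that]])
  moreover have "Poly_Mapping.lookup (Poly_Mapping.lookup (\<rho> x) e) 0 = 0" if x: "x \<in> free_on D" for x e
  proof (rule ccontr)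
    assume c: "Poly_Mapping.lookup (Poly_Mapping.lookup (\<rho> x) e) 0 \<noteq> 0"
    then have "e \<in> Poly_Mapping.keys (\<rho> x)" by (auto simp: in_keys_iff)
    then have e: "e \<in> D" using \<rho>_in[OF x] by (auto simp: free_on_def)
    have red: "syz m e \<in> ?d2 m ` free_on (D - {e})"
      by (rule syz_redundant_if_unit_coefficient[OF \<rho>_in[OF x] d2_\<rho>[OF x] c])
    have "K \<subseteq> ?d2 m ` free_on (D - {e})"
    proof -
      have "K = d2.m2.span (syz m ` D)"
        unfolding im[symmetric] tree_d2_eq by (rule lin_ext_image[OF module_fscale])
      also have "\<dots> \<subseteq> d2.m2.span (?d2 m ` free_on (D - {e}))"
      proof (rule d2.m2.span_minimal)
        show "syz m ` D \<subseteq> d2.m2.span (?d2 m ` free_on (D - {e}))"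
        proof (rule image_subsetI)
          fix f assume "f \<in> D"
          have "syz m f \<in> ?d2 m ` free_on (D - {e})"
          proof (cases "f = e")
            case False
            then have "basis_vec f \<in> free_on (D - {e})" using \<open>f \<in> D\<close> by (intro basis_vec_in_free_on) simp
            moreover have "?d2 m (basis_vec f) = syz m f" by (simp add: tree_d2_single)
            ultimately show ?thesis by (metis imageI)
          qed (use red in simp)
          then show "syz m f \<in> d2.m2.span (?d2 m ` free_on (D - {e}))" by (rule d2.m2.span_base)
        qed
      qed simp
      also have "\<dots> = ?d2 m ` free_on (D - {e})"
        by (simp add: d2.subspace_image subspace_free_on)
      finally show ?thesis .
    qed
    then have "card D \<le> card (D - {e})" using D(1) by (intro least) (auto simp: spanning_def)
    then show False using card_Diff1_less[OF \<open>finite D\<close> e] by simp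
  qed
  ultimately have \<rho>_eq_0: "\<rho> x = 0" if "x \<in> free_on D" for x
    using idempotent_into_max_ideal_eq_0[of D \<rho>] that by blast
  have inj: "inj_on (?d2 m) (free_on D)"
    unfolding inj_on_tree_d2_iff using \<rho>_eq_0 ker_\<rho> by metis
  show ?thesis
    using minimal_resolution_if_exact[OF I m(1) _ D(1)[unfolded pairs_def] inj D(2)[unfolded K_def]]
      gens(1) by (simp only: m(2))
qed

section \<open>Facets of the dual complex and elimination orders\<close>

definition sqfree_exp :: "'x::finite set \<Rightarrow> ('x \<Rightarrow>\<^sub>0 nat)" where
  "sqfree_exp \<sigma> = (\<Sum>x\<in>\<sigma>. Poly_Mapping.single x 1)"

lemma lookup_sqfree_exp: "Poly_Mapping.lookup (sqfree_exp \<sigma>) x = (if x \<in> \<sigma> then 1 else 0)"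
  by (simp add: sqfree_exp_def lookup_sum lookup_single when_def)

lemma sqfree_monomial_eq: "sqfree_monomial \<sigma> = monomial (sqfree_exp \<sigma>)"
  unfolding sqfree_monomial_def sqfree_exp_def
  by (induction rule: infinite_finite_induct) (simp_all add: monomial_0 var_def monomial_mult)

lemma sqfree_exp_divides_iff [simp]: "sqfree_exp \<sigma> \<preceq> sqfree_exp \<tau> \<longleftrightarrow> \<sigma> \<subseteq> \<tau>"
  by (auto simp: divides_exp_def lookup_sqfree_exp)

lemma sqfree_exp_divides_lcm_iff:
  "sqfree_exp \<rho> \<preceq> lcm_exp (sqfree_exp \<sigma>) (sqfree_exp \<tau>) \<longleftrightarrow> \<rho> \<subseteq> \<sigma> \<union> \<tau>"
  by (auto simp: divides_exp_def lookup_sqfree_exp lcm_exp.rep_eq max_def)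

lemma inj_sqfree_exp: "inj sqfree_exp"
  by (rule injI) (metis order_antisym divides_exp_refl sqfree_exp_divides_iff)

lemma sqfree_monomial_mem_iff:
  "(sqfree_monomial \<tau> :: _ \<Rightarrow>\<^sub>0 'k::field) \<in> ideal_gen (sqfree_monomial ` A) \<longleftrightarrow> (\<exists>\<sigma>\<in>A. \<sigma> \<subseteq> \<tau>)"
proof -
  have "sqfree_monomial ` A = (monomial ` sqfree_exp ` A :: (_ \<Rightarrow>\<^sub>0 'k) set)"
    by (simp add: sqfree_monomial_eq image_image)
  then show ?thesis by (simp add: sqfree_monomial_eq monomial_mem_ideal_gen_iff)
qed

definition min_supports :: "(('x::finite \<Rightarrow>\<^sub>0 nat) \<Rightarrow>\<^sub>0 'k::field) set \<Rightarrow> 'x set set" where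
  "min_supports I = {\<tau>. sqfree_monomial \<tau> \<in> I \<and> (\<forall>\<sigma>. sqfree_monomial \<sigma> \<in> I \<longrightarrow> \<sigma> \<subseteq> \<tau> \<longrightarrow> \<sigma> = \<tau>)}"

lemma minimal_monomial_generators_min_supports:
  assumes "sqfree_monomial_ideal I"
  shows "minimal_monomial_generators I (sqfree_exp ` min_supports I)"
proof -
  obtain A where A: "I = ideal_gen (sqfree_monomial ` A)"
    using assms by (auto simp: sqfree_monomial_ideal_def)
  have mem: "sqfree_monomial \<tau> \<in> I \<longleftrightarrow> (\<exists>\<sigma>\<in>A. \<sigma> \<subseteq> \<tau>)" for \<tau>
    unfolding A by (rule sqfree_monomial_mem_iff)
  have below: "\<exists>\<sigma>\<in>min_supports I. \<sigma> \<subseteq> \<tau>" if "\<tau> \<in> A" for \<tau>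
  proof -
    let ?S = "{\<sigma>. sqfree_monomial \<sigma> \<in> I}"
    have "\<tau> \<in> ?S" using that mem by blast
    from finite_has_minimal2[OF finite this] obtain \<sigma>
      where "\<sigma> \<in> ?S" "\<sigma> \<subseteq> \<tau>" "\<forall>\<rho>\<in>?S. \<rho> \<subseteq> \<sigma> \<longrightarrow> \<sigma> = \<rho>" by blast
    then show ?thesis by (intro bexI[of _ \<sigma>]) (auto simp: min_supports_def)
  qed
  have above: "\<exists>\<sigma>\<in>A. \<sigma> \<subseteq> \<tau>" if "\<tau> \<in> min_supports I" for \<tau>
    using that mem by (auto simp: min_supports_def)
  have "ideal_gen (monomial ` sqfree_exp ` min_supports I) = ideal_gen (monomial ` sqfree_exp ` A)"
  proof (rule ideal_gen_monomial_cong)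
    fix t
    have "(\<exists>\<sigma>\<in>min_supports I. sqfree_exp \<sigma> \<preceq> t) \<longleftrightarrow> (\<exists>\<sigma>\<in>A. sqfree_exp \<sigma> \<preceq> t)"
      using below above divides_exp_trans sqfree_exp_divides_iff by metis
    then show "(\<exists>g\<in>sqfree_exp ` min_supports I. g \<preceq> t) \<longleftrightarrow> (\<exists>g\<in>sqfree_exp ` A. g \<preceq> t)" by simp
  qed
  also have "\<dots> = I"
    by (simp add: A sqfree_monomial_eq image_image)
  finally have "ideal_gen (monomial ` sqfree_exp ` min_supports I) = I" .
  moreover have "exp_antichain (sqfree_exp ` min_supports I)"
    by (auto simp: exp_antichain_def min_supports_def)
  ultimately show ?thesis by (simp add: minimal_monomial_generators_iff)
qed

lemma sr_complex_sr_ideal: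
  assumes "\<And>\<sigma> \<tau>. \<tau> \<in> \<Delta> \<Longrightarrow> \<sigma> \<subseteq> \<tau> \<Longrightarrow> \<sigma> \<in> \<Delta>"
  shows "sr_complex (sr_ideal \<Delta> :: (_ \<Rightarrow>\<^sub>0 'k::field) set) = \<Delta>"
proof -
  have "{sqfree_monomial \<sigma> | \<sigma>. \<sigma> \<notin> \<Delta>} = (sqfree_monomial ` (- \<Delta>) :: (_ \<Rightarrow>\<^sub>0 'k) set)" by auto
  then show ?thesis
    using assms unfolding sr_complex_def sr_ideal_def by (auto simp: sqfree_monomial_mem_iff)
qed

text \<open>The dual complex consists of the complements of those sets whose monomial lies in \<open>I\<close>, so its
maximal faces are the complements of the minimal such sets.\<close>

lemma facets_dual_complex:
  assumes "sqfree_monomial_ideal I"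
  shows "facets (sr_complex (alexander_dual_ideal I)) = uminus ` min_supports I"
proof -
  obtain A where A: "I = ideal_gen (sqfree_monomial ` A)"
    using assms by (auto simp: sqfree_monomial_ideal_def)
  have mem: "sqfree_monomial \<tau> \<in> I \<longleftrightarrow> (\<exists>\<sigma>\<in>A. \<sigma> \<subseteq> \<tau>)" for \<tau>
    unfolding A by (rule sqfree_monomial_mem_iff)
  have dual: "\<tau> \<in> alexander_dual_complex (sr_complex I) \<longleftrightarrow> sqfree_monomial (- \<tau>) \<in> I" for \<tau>
    by (auto simp: alexander_dual_complex_def sr_complex_def Compl_eq_Diff_UNIV[symmetric]
        intro!: exI[of _ "- \<tau>"])
  have "\<sigma> \<in> alexander_dual_complex (sr_complex I)"
    if "\<tau> \<in> alexander_dual_complex (sr_complex I)" "\<sigma> \<subseteq> \<tau>" for \<sigma> \<tau>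
    using that unfolding dual mem by (meson Compl_anti_mono order_trans)
  then have "sr_complex (alexander_dual_ideal I) = alexander_dual_complex (sr_complex I)"
    unfolding alexander_dual_ideal_def by (rule sr_complex_sr_ideal)
  then have "\<tau> \<in> facets (sr_complex (alexander_dual_ideal I)) \<longleftrightarrow> - \<tau> \<in> min_supports I" for \<tau>
  proof -
    have all: "(\<forall>G. Q G) \<longleftrightarrow> (\<forall>\<sigma>. Q (- \<sigma>))" for Q :: "'a set \<Rightarrow> bool"
      by (metis double_complement)
    have "\<tau> \<subseteq> - \<sigma> \<longleftrightarrow> \<sigma> \<subseteq> - \<tau>" "- \<sigma> = \<tau> \<longleftrightarrow> \<sigma> = - \<tau>" for \<sigma> by blast+
    then have "(\<forall>G. sqfree_monomial (- G) \<in> I \<longrightarrow> \<tau> \<subseteq> G \<longrightarrow> G = \<tau>) \<longleftrightarrow>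
        (\<forall>\<sigma>. sqfree_monomial \<sigma> \<in> I \<longrightarrow> \<sigma> \<subseteq> - \<tau> \<longrightarrow> \<sigma> = - \<tau>)"
      by (subst all) simp
    then show ?thesis
      unfolding \<open>sr_complex (alexander_dual_ideal I) = _\<close> facets_def min_supports_def Ball_def mem_Collect_eq dual
      by simp
  qed
  moreover have "\<tau> \<in> uminus ` min_supports I \<longleftrightarrow> - \<tau> \<in> min_supports I" for \<tau>
    by (auto intro: image_eqI[of _ _ "- \<tau>"])
  ultimately show ?thesis by blast
qed

lemma facets_complex_generated:
  assumes "\<And>F G. F \<in> \<F> \<Longrightarrow> G \<in> \<F> \<Longrightarrow> F \<subseteq> G \<Longrightarrow> G = F"
  shows "facets (complex_generated \<F>) = \<F>"
proof (intro antisym subsetI)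
  fix F assume "F \<in> facets (complex_generated \<F>)"
  then obtain G where "G \<in> \<F>" "F \<subseteq> G" "\<forall>G\<in>complex_generated \<F>. F \<subseteq> G \<longrightarrow> G = F"
    by (auto simp: facets_def complex_generated_def)
  moreover from this have "G \<in> complex_generated \<F>" by (auto simp: complex_generated_def)
  ultimately show "F \<in> \<F>" by blast
next
  fix F assume F: "F \<in> \<F>"
  have "G = F" if "H \<in> \<F>" "G \<subseteq> H" "F \<subseteq> G" for G H
    using assms[OF F that(1)] that by blast
  with F show "F \<in> facets (complex_generated \<F>)"
    unfolding facets_def complex_generated_def by blast
qed

text \<open>Facets form an antichain, so they remain the facets of the subcomplexes generated by some of
them.\<close>

lemma quasi_forest_iff:
  "quasi_forest \<Delta> \<longleftrightarrow> (\<exists>Fs. distinct Fs \<and> set Fs = facets \<Delta> \<and>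
     (\<forall>i<length Fs. 0 < i \<longrightarrow> (\<exists>j<i. \<forall>h<i. Fs ! i \<inter> Fs ! h \<subseteq> Fs ! j)))"
proof -
  have leaf: "leaf (Fs ! i) (complex_generated (set (take (Suc i) Fs))) \<longleftrightarrow>
      (0 < i \<longrightarrow> (\<exists>j<i. \<forall>h<i. Fs ! i \<inter> Fs ! h \<subseteq> Fs ! j))"
    if Fs: "distinct Fs" "set Fs = facets \<Delta>" and i: "i < length Fs" for Fs i
  proof -
    let ?F = "set (take (Suc i) Fs)"
    have set_take: "?F = insert (Fs ! i) ((!) Fs ` {..<i})"
      using i by (simp add: take_Suc_conv_app_nth nth_image[symmetric] lessThan_atLeast0 del: nth_image)
    have facets: "facets (complex_generated ?F) = ?F"
    proof (rule facets_complex_generated)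
      fix F G assume "F \<in> ?F" "G \<in> ?F" "F \<subseteq> G"
      then have "F \<in> facets \<Delta>" "G \<in> facets \<Delta>" using Fs(2) by (auto dest: in_set_takeD)
      with \<open>F \<subseteq> G\<close> show "G = F" by (auto simp: facets_def)
    qed
    have ne: "Fs ! j \<noteq> Fs ! i" if "j < i" for j
      using Fs(1) i that by (simp add: nth_eq_iff_index_eq)
    show ?thesis
    proof (cases "i = 0")
      case True
      then show ?thesis unfolding leaf_def facets using set_take by simp
    next
      case False
      then have "Fs ! 0 \<in> ?F" "Fs ! 0 \<noteq> Fs ! i" using ne by (auto simp: set_take)
      then have "?F \<noteq> {Fs ! i}" by blast
      then show ?thesis unfolding leaf_def facets using False ne by (auto simp: set_take)
    qed
  qed
  then show ?thesis unfolding quasi_forest_def by (metis (no_types, lifting))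
qed

lemma quasi_forest_dual_iff_elim_order:
  assumes "sqfree_monomial_ideal I"
  shows "quasi_forest (sr_complex (alexander_dual_ideal I)) \<longleftrightarrow>
    (\<exists>ts. set ts = sqfree_exp ` min_supports I \<and> lcm_elim_order ts)"
proof -
  let ?F = "facets (sr_complex (alexander_dual_ideal I))"
  define g where "g F = sqfree_exp (- F)" for F :: "'a set"
  have inj: "inj g" unfolding g_def by (rule injI) (metis injD[OF inj_sqfree_exp] double_complement)
  have gF: "g ` ?F = sqfree_exp ` min_supports I"
    by (simp add: facets_dual_complex[OF assms] g_def image_image)
  have elim: "lcm_elim_order (map g Fs) \<longleftrightarrow> distinct Fs \<and>
      (\<forall>i<length Fs. 0 < i \<longrightarrow> (\<exists>j<i. \<forall>h<i. Fs ! i \<inter> Fs ! h \<subseteq> Fs ! j))" for Fs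
  proof -
    have g: "g K \<preceq> lcm_exp (g F) (g H) \<longleftrightarrow> F \<inter> H \<subseteq> K" for F H K
      unfolding g_def sqfree_exp_divides_lcm_iff by blast
    have "map g Fs ! j \<preceq> lcm_exp (map g Fs ! i) (map g Fs ! h) \<longleftrightarrow> Fs ! i \<inter> Fs ! h \<subseteq> Fs ! j"
      if "i < length Fs" "j < i" "h < i" for i j h
      using that by (simp add: g)
    then show ?thesis
      by (simp add: lcm_elim_order_def distinct_map inj_on_subset[OF inj] cong: conj_cong)
  qed
  show ?thesis
  proof
    assume "quasi_forest (sr_complex (alexander_dual_ideal I))"
    then obtain Fs where "set Fs = ?F" "lcm_elim_order (map g Fs)"
      unfolding quasi_forest_iff elim by blast
    then show "\<exists>ts. set ts = sqfree_exp ` min_supports I \<and> lcm_elim_order ts"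
      using gF by (intro exI[of _ "map g Fs"]) simp
  next
    assume "\<exists>ts. set ts = sqfree_exp ` min_supports I \<and> lcm_elim_order ts"
    then obtain ts where ts: "set ts = g ` ?F" "lcm_elim_order ts" unfolding gF by blast
    then have "\<forall>t\<in>set ts. \<exists>F. t = g F" by auto
    then obtain Fs where Fs: "ts = map g Fs" unfolding ex_map_conv[symmetric] by blast
    have "g ` set Fs = g ` ?F" using ts(1) by (simp add: Fs)
    then have "set Fs = ?F" by (simp only: inj_image_eq_iff[OF inj])
    then show "quasi_forest (sr_complex (alexander_dual_ideal I))"
      using ts(2) unfolding quasi_forest_iff Fs elim by blast
  qed
qed

lemma proj_dim_le_1_if_minimal_resolution:
  fixes I :: "(('x::finite \<Rightarrow>\<^sub>0 nat) \<Rightarrow>\<^sub>0 'k::field) set"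
  assumes "minimal_resolution_supported_on_tree I"
  shows "proj_dim TYPE('u::infinite) (*) I \<le> 1"
proof -
  obtain r m E where "tree_resolves {1..r} E m I"
    using assms unfolding minimal_resolution_supported_on_tree_def by blast
  then show ?thesis unfolding tree_resolves_def
    by (intro proj_dim_le_1_if_free_resolution[of "(*)" "tree_d1 m" "{1..r}" I "tree_d2 m" "oriented_edges E"]
        module_hom_tree_d1 module_hom_tree_d2) blast+
qed

theorem theorem1:
  fixes I :: "(('x::finite \<Rightarrow>\<^sub>0 nat) \<Rightarrow>\<^sub>0 'k::field) set"
  assumes "sqfree_monomial_ideal I" "I \<noteq> {0}" "I \<noteq> UNIV"
  shows "(proj_dim TYPE('u::infinite) (*) I \<le> 1
            \<longleftrightarrow> quasi_forest (sr_complex (alexander_dual_ideal I)))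
       \<and> (quasi_forest (sr_complex (alexander_dual_ideal I))
            \<longleftrightarrow> minimal_resolution_supported_on_tree I)"
proof -
  let ?G = "sqfree_exp ` min_supports I"
  have gens: "minimal_monomial_generators I ?G"
    by (rule minimal_monomial_generators_min_supports[OF assms(1)])
  have "\<exists>ts. set ts = ?G \<and> lcm_elim_order ts" if tree: "minimal_resolution_supported_on_tree I"
  proof -
    obtain r m E where res: "inj_on m {1..r}" "minimal_monomial_generators I (m ` {1..r})"
        "is_tree {1..r} E" "tree_resolves {1..r} E m I"
      using tree unfolding minimal_resolution_supported_on_tree_def by blast
    have "m ` {1..r} = ?G" by (rule minimal_monomial_generators_unique[OF res(2) gens])
    then show ?thesis using elim_order_if_tree_resolves[OF res(3) _ res(4,1)] by simp
  qed
  moreover have "minimal_resolution_supported_on_tree I" if "set ts = ?G" "lcm_elim_order ts" for ts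
    using minimal_resolution_if_elim_order[OF assms(2,3) _ that(2)] gens that(1) by simp
  ultimately have "quasi_forest (sr_complex (alexander_dual_ideal I))
      \<longleftrightarrow> minimal_resolution_supported_on_tree I"
    unfolding quasi_forest_dual_iff_elim_order[OF assms(1)] by blast
  moreover have "proj_dim TYPE('u) (*) I \<le> 1 \<longleftrightarrow> minimal_resolution_supported_on_tree I"
    using minimal_resolution_if_proj_dim_le_1[OF assms(2,3) gens]
      proj_dim_le_1_if_minimal_resolution[of I] by auto
  ultimately show ?thesis by blast
qed

end
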